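(* Assume that the collision kernel has separated form with exponent $\beta\in(1-D,1]$. Let $\mathcal M$ be a global Maxwellian with $\nu(\mathcal M)<\tfrac14$. Let $F_1^{\mathrm{in}},F_2^{\mathrm{in}}\in\mathcal Y_{\mathcal M(0)}$ be such that $$\epsilon:=\max\left(|F_1^{\mathrm{in}}-\mathcal M(0)|_{\mathcal M(0)},|F_2^{\mathrm{in}}-\mathcal M(0)|_{\mathcal M(0)}\right)<\frac{(1-4\nu(\mathcal M))^2}{8\nu(\mathcal M)}.$$ Let $F_1(t)=S_tF_1^{\mathrm{in}}$ and $F_2(t)=S_tF_2^{\mathrm{in}}$ for all $t\in\mathbb R$. Then $$\|F_1-F_2\|_{\mathcal M}\le\frac{|F_1^{\mathrm{in}}-F_2^{\mathrm{in}}|_{\mathcal M(0)}}{\sqrt{(1-4\nu(\mathcal M))^2-8\nu(\mathcal M)\epsilon}}.$$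
   Context: Collision kernel and collision integral. $D\ge1$ is an integer. A collision kernel of separated form with exponent $\beta$ is $\mathsf b(z,\omega)=|z|^\beta\hat{\mathsf b}(\omega\cdot z/|z|)$, $z\in\mathbb R^D$, $\omega\in\mathbb S^{D-1}$, where $\hat{\mathsf b}\ge0$ is measurable and $0<\bar{\mathsf b}:=\int_{\mathbb S^{D-1}}\hat{\mathsf b}(\omega\cdot n)\,d\omega<\infty$ ($n$ any unit vector). With $v'=v-((v-v_* )\cdot\omega)\omega$ and $v_*'=v_*+((v-v_* )\cdot\omega)\omega$, the collision integral is $$\mathcal B(F,F)(v,x,t)=\iint_{\mathbb S^{D-1}\times\mathbb R^D}\big(F(v',x,t)F(v'_*,x,t)-F(v,x,t)F(v_*,x,t)\big)\mathsf b(v-v_*,\omega)\,d\omega\,dv_*,$$ and $\mathcal A(F)(v,x,t):=\bar{\mathsf b}\int_{\mathbb R^D}F(v_*,x,t)|v-v_*|^\beta\,dv_*$. The Boltzmann equation is $\partial_tF+v\cdot\nabla_xF=\mathcal B(F,F)$. Functions $F$ are real valued (not assumed nonnegative). Global Maxwellians (of finite mass) are the functions $$\mathcal M(v,x,t)=\frac{m}{(2\pi)^D}\sqrt{\det Q}\;e^{-q(v-v_0,x-x_0,t)},\qquad q(v,x,t)=\tfrac12\big(c|v|^2+a|x-tv|^2+2b(x-tv)\cdot v\big)-v\cdot B(x-tv),$$ with $m,a,c>0$, $b\in\mathbb R$, $x_0,v_0\in\mathbb R^D$, $B$ a real skew-symmetric $D\times D$ matrix such that $Q:=(ac-b^2)I+B^2$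 is positive definite. They satisfy $\partial_t\mathcal M+v\cdot\nabla_x\mathcal M=0$ and $\mathcal B(\mathcal M,\mathcal M)=0$. $\mathcal M(t)$ denotes $(v,x)\mapsto\mathcal M(v,x,t)$. The constant $\nu$: for $\beta\in(1-D,1]$, $$\nu(\mathcal M):=\sup_{(v,x,t)\in\mathbb R^D\times\mathbb R^D\times\mathbb R}\left|\int_{\mathbb R}\mathcal A(\mathcal M)(v,x-tv+sv,s)\,ds\right|,$$ which is finite. Spaces: $\mathcal X_{\mathcal M}:=\mathcal M L^\infty(\mathbb R^D\times\mathbb R^D\times\mathbb R)$ with norm $\|F\|_{\mathcal M}:=\|F/\mathcal M\|_{L^\infty}$; $\mathcal Y_{\mathcal M(0)}:=\mathcal M(0)L^\infty(\mathbb R^D\times\mathbb R^D)$ with norm $|f|_{\mathcal M(0)}:=\|f/\mathcal M(0)\|_{L^\infty}$. Mild solutions: $e^{t\mathsf A}$ is defined by $(e^{t\mathsf A}\phi)(v,x)=\phi(v,x+tv)$. A mild solution on $\mathbb R^D\times\mathbb R^D\times I$ ($I\subset\mathbb R$ an interval) is $F\in L^1_{loc}(\mathbb R^D\times\mathbb R^D\times I)$ with $\mathcal B(F,F)\in L^1_{loc}(\mathbb R^D\times\mathbb R^D\times I)$ and $$e^{t_2\mathsf A}F(v,x,t_2)=e^{t_1\mathsf A}F(v,x,t_1)+\int_{t_1}^{t_2}e^{s\mathsf A}\mathcal B(F,F)(v,x,s)\,ds$$ for a.e. $(v,x)\in\mathbb R^D\times\mathbb R^D$ and all $t_1,t_2\in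 I$. $F$ is identified with its representative in $C(I;L^1_{loc}(\mathbb R^D\times\mathbb R^D))$, and $F(t)$ denotes $(v,x)\mapsto F(v,x,t)$. The solution group $S_t$: when $\nu(\mathcal M)<\tfrac14$ and $|F^{\mathrm{in}}-\mathcal M(0)|_{\mathcal M(0)}<\frac{(1-4\nu(\mathcal M))^2}{8\nu(\mathcal M)}$, there is a unique mild solution $F\in\mathcal X_{\mathcal M}$ on $\mathbb R^D\times\mathbb R^D\times\mathbb R$ with $F(0)=F^{\mathrm{in}}$ and $\|F-\mathcal M\|_{\mathcal M}\le r$, where $$r=\left(\frac1{4\nu(\mathcal M)}-1\right)\left(1-\sqrt{1-\frac{8\nu(\mathcal M)|F^{\mathrm{in}}-\mathcal M(0)|_{\mathcal M(0)}}{(1-4\nu(\mathcal M))^2}}\right);$$ one writes $S_tF^{\mathrm{in}}:=F(t)$, $t\in\mathbb R$, for this solution.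
   Formalization: The exponent of a global Maxwellian is taken as q(v-v_0, x-x_0-tv_0, t) instead of q(v-v_0, x-x_0, t): for v_0≠0 the printed formula does not satisfy the free transport equation, so M is not a solution and S_t M(0) is undefined. *)

theory Defs
  imports "HOL-Analysis.Analysis" "HOL-Probability.Essential_Supremum"
begin

text \<open>
  The dimension \<open>D\<close> is \<open>CARD('n)\<close>. Elements of \<open>L\<^sup>\<infinity>\<close> and of local \<open>L\<^sup>1\<close> spaces are represented by
  Borel functions; every almost-everywhere class has such a representative, and all norms and
  conditions below are invariant under changes on null sets.
\<close>

section \<open>Surface measure and collision kernel\<close>

text \<open>
  The surface measure on the unit sphere, as a Borel measure on the whole space concentrated on
  the sphere: \<open>\<sigma>(A)\<close> is \<open>D\<close> times the Lebesgue measure of the part of the unit ball lying in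
  directions \<open>x/|x| \<in> A\<close> (polar coordinates). For \<open>D = 1\<close> it is the counting measure on
  \<open>{-1, 1}\<close>.
\<close>

definition sphere_measure :: "(real^'n) measure" where
  "sphere_measure =
     distr (density lborel (\<lambda>x. of_nat CARD('n) * indicator (ball 0 1) x)) borel sgn"

text \<open>By rotation invariance this does not depend on the unit vector that is chosen.\<close>

definition angular_mass :: "'n::finite itself \<Rightarrow> (real \<Rightarrow> real) \<Rightarrow> real" where
  "angular_mass _ bhat =
     (LINT \<omega>|sphere_measure. bhat (\<omega> \<bullet> (SOME n :: real^'n. norm n = 1)))"

text \<open>
  The angular part of a separated kernel. Only its values on \<open>[-1, 1]\<close> matter; it is totalized by
  an arbitrary Borel extension.
\<close>

definition angular_kernel :: "'n::finite itself \<Rightarrow> (real \<Rightarrow> real) \<Rightarrow> bool" where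
  "angular_kernel _ bhat \<longleftrightarrow>
     bhat \<in> borel_measurable borel \<and> (\<forall>s\<in>{-1..1}. 0 \<le> bhat s) \<and>
     (\<forall>n :: real^'n. norm n = 1 \<longrightarrow>
        integrable sphere_measure (\<lambda>\<omega>. bhat (\<omega> \<bullet> n)) \<and>
        0 < (LINT \<omega>|sphere_measure. bhat (\<omega> \<bullet> n)))"

text \<open>
  \<open>sgn z = z/|z|\<close>. At \<open>z = 0\<close> the value is \<open>0\<close> for every \<open>\<beta>\<close>; the diagonal
  \<open>v = v\<^sub>*\<close> is a null set.
\<close>

definition collision_kernel :: "real \<Rightarrow> (real \<Rightarrow> real) \<Rightarrow> real^'n \<Rightarrow> real^'n \<Rightarrow> real" where
  "collision_kernel \<beta> bhat z \<omega> = norm z powr \<beta> * bhat (\<omega> \<bullet> sgn z)"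

section \<open>Collision integral\<close>

definition post_v :: "real^'n \<Rightarrow> real^'n \<Rightarrow> real^'n \<Rightarrow> real^'n" where
  "post_v v w \<omega> = v - ((v - w) \<bullet> \<omega>) *\<^sub>R \<omega>"

definition post_w :: "real^'n \<Rightarrow> real^'n \<Rightarrow> real^'n \<Rightarrow> real^'n" where
  "post_w v w \<omega> = w + ((v - w) \<bullet> \<omega>) *\<^sub>R \<omega>"

text \<open>Arguments are ordered \<open>(v, x, t)\<close>; \<open>w\<close> stands for \<open>v\<^sub>*\<close>.\<close>

definition collision_integrand ::
  "real \<Rightarrow> (real \<Rightarrow> real) \<Rightarrow> ((real^'n) \<times> (real^'n) \<times> real \<Rightarrow> real) \<Rightarrow>
   (real^'n) \<times> (real^'n) \<times> real \<Rightarrow> (real^'n) \<times> (real^'n) \<Rightarrow> real" where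
  "collision_integrand \<beta> bhat F = (\<lambda>(v, x, t) (\<omega>, w).
     (F (post_v v w \<omega>, x, t) * F (post_w v w \<omega>, x, t) - F (v, x, t) * F (w, x, t)) *
     collision_kernel \<beta> bhat (v - w) \<omega>)"

definition collision_integral ::
  "real \<Rightarrow> (real \<Rightarrow> real) \<Rightarrow> ((real^'n) \<times> (real^'n) \<times> real \<Rightarrow> real) \<Rightarrow>
   (real^'n) \<times> (real^'n) \<times> real \<Rightarrow> real" where
  "collision_integral \<beta> bhat F p =
     (LINT y|(sphere_measure \<Otimes>\<^sub>M lborel). collision_integrand \<beta> bhat F p y)"

definition collision_frequency ::
  "real \<Rightarrow> (real \<Rightarrow> real) \<Rightarrow> ((real^'n) \<times> (real^'n) \<times> real \<Rightarrow> real) \<Rightarrow>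
   (real^'n) \<times> (real^'n) \<times> real \<Rightarrow> real" where
  "collision_frequency \<beta> bhat F = (\<lambda>(v, x, t).
     angular_mass TYPE('n) bhat * (LINT w|lborel. F (w, x, t) * norm (v - w) powr \<beta>))"

section \<open>Global Maxwellians\<close>

definition maxwellian_form ::
  "real \<Rightarrow> real \<Rightarrow> real \<Rightarrow> real^'n^'n \<Rightarrow> real^'n \<Rightarrow> real^'n \<Rightarrow> real \<Rightarrow> real" where
  "maxwellian_form a b c B v x t =
     1/2 * (c * (norm v)\<^sup>2 + a * (norm (x - t *\<^sub>R v))\<^sup>2 + 2 * b * ((x - t *\<^sub>R v) \<bullet> v))
     - v \<bullet> (B *v (x - t *\<^sub>R v))"

definition maxwellian_matrix :: "real \<Rightarrow> real \<Rightarrow> real \<Rightarrow> real^'n^'n \<Rightarrow> real^'n^'n" where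
  "maxwellian_matrix a b c B = mat (a * c - b\<^sup>2) + B ** B"

text \<open>
  The bulk velocity \<open>v0\<close> enters by a Galilean boost: the centre in space at time \<open>t\<close> is
  \<open>x0 + t v0\<close>, so that the exponent depends on \<open>(x, t)\<close> through \<open>x - t v\<close> only. This is what makes
  \<open>M\<close> a solution of the free transport equation. With the fixed centre \<open>x0\<close>, the exponent
  would depend on \<open>x - t (v - v0)\<close>, and transport would hold only for \<open>v0 = 0\<close>.
\<close>

definition global_maxwellian :: "((real^'n) \<times> (real^'n) \<times> real \<Rightarrow> real) \<Rightarrow> bool" where
  "global_maxwellian M \<longleftrightarrow>
     (\<exists>m a b c v0 x0 B.
        0 < m \<and> 0 < a \<and> 0 < c \<and> transpose B = - B \<and>
        (\<forall>u. u \<noteq> 0 \<longrightarrow> 0 < u \<bullet> (maxwellian_matrix a b c B *v u)) \<and>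
        M = (\<lambda>(v, x, t). m / (2 * pi) ^ CARD('n) * sqrt (det (maxwellian_matrix a b c B)) *
               exp (- maxwellian_form a b c B (v - v0) (x - x0 - t *\<^sub>R v0) t)))"

lemma global_maxwellian_free_transport:
  assumes "global_maxwellian M"
  shows "M (v, x + s *\<^sub>R v, t + s) = M (v, x, t)"
proof -
  have shift: "(x + s *\<^sub>R v - x0 - (t + s) *\<^sub>R v0) - (t + s) *\<^sub>R (v - v0) =
      (x - x0 - t *\<^sub>R v0) - t *\<^sub>R (v - v0)" for x0 v0
    by (simp add: algebra_simps)
  show ?thesis
    using assms by (auto simp: global_maxwellian_def maxwellian_form_def shift)
qed

definition nu ::
  "real \<Rightarrow> (real \<Rightarrow> real) \<Rightarrow> ((real^'n) \<times> (real^'n) \<times> real \<Rightarrow> real) \<Rightarrow> real" where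
  "nu \<beta> bhat M = (SUP (v, x, t)\<in>UNIV.
     \<bar>LINT s|lborel. collision_frequency \<beta> bhat M (v, x - t *\<^sub>R v + s *\<^sub>R v, s)\<bar>)"

section \<open>Weighted spaces\<close>

text \<open>
  \<open>w L\<^sup>\<infinity>\<close> with the norm \<open>\<parallel>f/w\<parallel>\<close>. The norm is meaningful on the space only
  (\<open>real_of_ereal\<close> sends \<open>\<infinity>\<close> to \<open>0\<close>).
\<close>

definition weighted_Linf :: "('a::euclidean_space \<Rightarrow> real) \<Rightarrow> ('a \<Rightarrow> real) set" where
  "weighted_Linf w =
     {f \<in> borel_measurable borel. esssup lborel (\<lambda>p. ereal \<bar>f p / w p\<bar>) < \<infinity>}"

definition weighted_norm :: "('a::euclidean_space \<Rightarrow> real) \<Rightarrow> ('a \<Rightarrow> real) \<Rightarrow> real" where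
  "weighted_norm w f = real_of_ereal (esssup lborel (\<lambda>p. ereal \<bar>f p / w p\<bar>))"

definition time_slice ::
  "((real^'n) \<times> (real^'n) \<times> real \<Rightarrow> real) \<Rightarrow> real \<Rightarrow> (real^'n) \<times> (real^'n) \<Rightarrow> real" where
  "time_slice F t = (\<lambda>(v, x). F (v, x, t))"

section \<open>Mild solutions\<close>

definition locally_integrable_on :: "('a::euclidean_space \<Rightarrow> real) \<Rightarrow> 'a set \<Rightarrow> bool" where
  "locally_integrable_on f S \<longleftrightarrow> (\<forall>K. compact K \<and> K \<subseteq> S \<longrightarrow> set_integrable lborel K f)"

definition transport :: "real \<Rightarrow> ((real^'n) \<times> (real^'n) \<Rightarrow> real) \<Rightarrow> (real^'n) \<times> (real^'n) \<Rightarrow> real" where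
  "transport t \<phi> = (\<lambda>(v, x). \<phi> (v, x + t *\<^sub>R v))"

text \<open>
  The almost-everywhere integrability clause says that the collision integral is well defined, since
  the Bochner integral of a non-integrable function is \<open>0\<close>. The exceptional set of \<open>(v, x)\<close> in the
  last clause does not depend on the times, so \<open>F\<close> is the representative that is continuous
  in time with values in local \<open>L\<^sup>1\<close>, and its time slices are unambiguous almost everywhere.
\<close>

definition mild_solution ::
  "real \<Rightarrow> (real \<Rightarrow> real) \<Rightarrow> real set \<Rightarrow> ((real^'n) \<times> (real^'n) \<times> real \<Rightarrow> real) \<Rightarrow> bool" where
  "mild_solution \<beta> bhat I F \<longleftrightarrow>
     is_interval I \<and>
     locally_integrable_on F (UNIV \<times> UNIV \<times> I) \<and>
     (AE p in lborel. p \<in> UNIV \<times> UNIV \<times> I \<longrightarrow>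
        integrable (sphere_measure \<Otimes>\<^sub>M lborel) (collision_integrand \<beta> bhat F p)) \<and>
     locally_integrable_on (collision_integral \<beta> bhat F) (UNIV \<times> UNIV \<times> I) \<and>
     (AE z in lborel. \<forall>t1\<in>I. \<forall>t2\<in>I.
        transport t2 (time_slice F t2) z =
        transport t1 (time_slice F t1) z +
        (LBINT s=t1..t2. transport s (time_slice (collision_integral \<beta> bhat F) s) z))"

text \<open>
  \<open>solution_orbit \<beta> bhat M Fin F\<close> is the characterization of \<open>F(t) = S\<^sub>t Fin\<close> for all
  real \<open>t\<close>: \<open>F\<close> is the (unique up to null sets) mild solution within the distance \<open>r\<close> of \<open>M\<close>
  with initial datum \<open>Fin\<close>. It is meant for \<open>nu \<beta> bhat M < 1/4\<close> and data in the smallness ball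
  of radius \<open>(1 - 4 \<nu>)\<^sup>2 / (8 \<nu>)\<close> around \<open>M(0)\<close>.
\<close>

definition orbit_radius ::
  "real \<Rightarrow> (real \<Rightarrow> real) \<Rightarrow> ((real^'n) \<times> (real^'n) \<times> real \<Rightarrow> real) \<Rightarrow>
   ((real^'n) \<times> (real^'n) \<Rightarrow> real) \<Rightarrow> real" where
  "orbit_radius \<beta> bhat M Fin =
     (1 / (4 * nu \<beta> bhat M) - 1) *
     (1 - sqrt (1 - 8 * nu \<beta> bhat M *
                    weighted_norm (time_slice M 0) (\<lambda>z. Fin z - time_slice M 0 z) /
                    (1 - 4 * nu \<beta> bhat M)\<^sup>2))"

definition solution_orbit ::
  "real \<Rightarrow> (real \<Rightarrow> real) \<Rightarrow> ((real^'n) \<times> (real^'n) \<times> real \<Rightarrow> real) \<Rightarrow>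
   ((real^'n) \<times> (real^'n) \<Rightarrow> real) \<Rightarrow> ((real^'n) \<times> (real^'n) \<times> real \<Rightarrow> real) \<Rightarrow> bool" where
  "solution_orbit \<beta> bhat M Fin F \<longleftrightarrow>
     F \<in> weighted_Linf M \<and>
     mild_solution \<beta> bhat UNIV F \<and>
     (AE z in lborel. time_slice F 0 z = Fin z) \<and>
     weighted_norm M (\<lambda>p. F p - M p) \<le> orbit_radius \<beta> bhat M Fin"

end

theory Submission
  imports Defs "HOL-Probability.Distributions"
begin

text \<open>
  Write \<open>F1 F1\<^sub>* - F2 F2\<^sub>* = (D S\<^sub>* + S D\<^sub>*)/2\<close> with \<open>D = F1 - F2\<close> and \<open>S = F1 + F2\<close>. Since
  \<open>M(v') M(v'\<^sub>*) = M(v) M(v\<^sub>*)\<close>, the difference of the two collision integrals is at most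
  \<open>2 |D| |S| M A(M)\<close> in terms of the weighted norms. Along a characteristic \<open>M\<close> is constant and the
  time integral of \<open>A(M)\<close> is at most \<open>\<nu>\<close>, so that \<open>|D| \<le> |D(0)| + 2 \<nu> |D| |S|\<close> with
  \<open>|S| \<le> 2 + r1 + r2\<close>, where \<open>r1\<close> and \<open>r2\<close> are the distances to \<open>M\<close>. The radius \<open>r\<close> is such that
  \<open>1 - 4 \<nu> (1 + r)\<close> is the square root in the claim. Since \<open>\<nu>\<close> is a supremum of Bochner integrals,
  its finiteness has to be established as well: the exponent of \<open>M\<close> is coercive in \<open>v\<close> and \<open>x - t v\<close>.
\<close>

section \<open>Gaussian and power integrals\<close>

text \<open>The inequality |D| \<le> |D(0)| + 2 \<nu> |D| |S| is linear in |D|, and |D| is finite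
  beforehand because both solutions lie in the weighted space; it is therefore solved for |D|
  without a Gronwall argument, provided 2 \<nu> |S| < 1. That is what the radius secures: r is the
  smaller root of 2 \<nu> r^2 - (1 - 4 \<nu>) r + e = 0, the fixed-point equation r = e + 2 \<nu> (2
  r + r^2) for a datum at distance e. Two features of the definitions cause most of the work. Bounds
  hold only almost everywhere, yet the collision integral evaluates the functions at four velocities
  at once and the Duhamel formula evaluates them on single characteristics, so null sets must be
  carried through both changes of variables. Moreover, Bochner integrals default to 0 and a real
  supremum is informative only for a bounded set, so the estimates are made with nonnegative
  integrals, and the integrability they yield is used to return to the real-valued
  quantities.\<close>

lemma ennreal_prod_less_top:
  fixes f :: "'i \<Rightarrow> ennreal"
  assumes "\<And>i. i \<in> I \<Longrightarrow> f i < top"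
  shows "prod f I < top"
  using assms by (induction I rule: infinite_finite_induct) (auto simp: ennreal_mult_less_top)

lemma nn_integral_exp_neg_square_finite:
  fixes \<delta> c :: real
  assumes "0 < \<delta>"
  shows "(\<integral>\<^sup>+u. ennreal (exp (- \<delta> * (u - c)\<^sup>2)) \<partial>lborel) < \<infinity>"
proof -
  define \<sigma> where "\<sigma> = sqrt (1 / (2 * \<delta>))"
  have \<sigma>: "\<sigma> > 0" "2 * \<sigma>\<^sup>2 = 1 / \<delta>"
    using assms by (auto simp: \<sigma>_def)
  have "exp (- \<delta> * (u - c)\<^sup>2) = sqrt (2 * pi * \<sigma>\<^sup>2) * normal_density c \<sigma> u" for u
    using \<sigma> assms by (simp add: normal_density_def field_simps)
  then have "integrable lborel (\<lambda>u. exp (- \<delta> * (u - c)\<^sup>2))"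
    using \<sigma> by simp
  then show ?thesis
    by (simp add: integrable_iff_bounded)
qed

text \<open>The Gaussian is a product over \<open>Basis\<close> of one-dimensional ones, so Tonelli
  reduces the claim to the integral on the line.\<close>

lemma nn_integral_gaussian_finite:
  fixes c :: "'a::euclidean_space"
  assumes "0 < \<delta>"
  shows "(\<integral>\<^sup>+w. ennreal (exp (- \<delta> * (norm (w - c))\<^sup>2)) \<partial>lborel) < \<infinity>"
proof -
  have "ennreal (exp (- \<delta> * (norm (w - c))\<^sup>2)) =
      (\<Prod>b\<in>Basis. ennreal (exp (- \<delta> * (w \<bullet> b - c \<bullet> b)\<^sup>2)))" for w
  proof -
    have "(norm (w - c))\<^sup>2 = (\<Sum>b\<in>Basis. (w \<bullet> b - c \<bullet> b)\<^sup>2)"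
      unfolding power2_norm_eq_inner euclidean_inner[of "w - c" "w - c"]
      by (simp add: inner_diff_left power2_eq_square)
    then show ?thesis
      by (simp add: prod_ennreal exp_sum[symmetric] sum_distrib_left)
  qed
  then show ?thesis
    using nn_integral_exp_neg_square_finite[OF assms]
    using nn_integral_lborel_prod[where f = "\<lambda>b u. ennreal (exp (- \<delta> * (u - c \<bullet> b)\<^sup>2))" and 'a = 'a]
    by (auto intro!: ennreal_prod_less_top)
qed

lemma nn_integral_powr_near_0_finite:
  fixes \<alpha> :: real
  assumes "-1 < \<alpha>"
  shows "(\<integral>\<^sup>+t. ennreal (indicator {-1..1} t * \<bar>t\<bar> powr \<alpha>) \<partial>lborel) < \<infinity>"
proof -
  have pos: "(\<integral>\<^sup>+t. ennreal (indicator {0..1} t * t powr \<alpha>) \<partial>lborel) < \<infinity>"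
  proof -
    have "(\<integral>\<^sup>+t. ennreal (t powr \<alpha> * indicator {0..1} t) \<partial>lborel) = ennreal (1 powr (\<alpha>+1) / (\<alpha>+1))"
      by (rule nn_integral_has_integral_lborel)
         (use has_integral_restrict_UNIV[of "{0..1}" "\<lambda>t. t powr \<alpha>"] has_integral_powr_from_0[OF assms, of 1]
           in \<open>simp_all add: indicator_def of_bool_def if_distrib cong: if_cong\<close>)
    then show ?thesis by (simp add: mult.commute)
  qed
  have neg: "(\<integral>\<^sup>+t. ennreal (indicator {0..1} (-t) * (-t) powr \<alpha>) \<partial>lborel) < \<infinity>"
    using pos nn_integral_real_affine[of "\<lambda>t. ennreal (indicator {0..1} t * t powr \<alpha>)" "-1" 0]
    by simp
  have "(\<integral>\<^sup>+t. ennreal (indicator {-1..1} t * \<bar>t\<bar> powr \<alpha>) \<partial>lborel) \<le>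
      (\<integral>\<^sup>+t. ennreal (indicator {0..1} t * t powr \<alpha>) +
            ennreal (indicator {0..1} (-t) * (-t) powr \<alpha>) \<partial>lborel)"
    by (intro nn_integral_mono) (auto simp: indicator_def)
  also have "\<dots> < \<infinity>"
    using pos neg by (subst nn_integral_add) auto
  finally show ?thesis .
qed

text \<open>The singularity is spread evenly over the coordinates: as \<alpha> = \<gamma>/D is not
  positive and each coordinate is at most the norm, |z|^\<gamma> is at most the product of the |z
  \<bullet> b|^\<alpha>. The exponent \<alpha> exceeds -1, so each factor is integrable on [-1, 1].
  Polar coordinates are avoided.\<close>

lemma nn_integral_norm_powr_ball_finite:
  assumes "- real DIM('a) < \<gamma>" "\<gamma> \<le> 0"
  shows "(\<integral>\<^sup>+z. ennreal (indicator (cball 0 1) (z::'a::euclidean_space) * norm z powr \<gamma>) \<partial>lborel) < \<infinity>"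
proof -
  define \<alpha> where "\<alpha> = \<gamma> / DIM('a)"
  have \<alpha>: "-1 < \<alpha>" "\<alpha> \<le> 0"
    using assms by (auto simp: \<alpha>_def field_simps)
  \<comment> \<open>\<open>0 powr \<alpha>\<close> is 0, so the product bound can fail where a
    coordinate vanishes; these hyperplanes form a null set.\<close>
  have null: "AE z in lborel. \<forall>b\<in>(Basis::'a set). z \<bullet> b \<noteq> 0"
  proof (rule AE_finite_allI)
    fix b :: 'a assume "b \<in> Basis"
    then have "negligible {z::'a. b \<bullet> z = 0}"
      by (intro negligible_hyperplane) auto
    moreover have "{z::'a. b \<bullet> z = 0} \<in> sets lborel"
      by (simp add: borel_closed closed_hyperplane)
    ultimately have "{z::'a. b \<bullet> z = 0} \<in> null_sets lborel"
      by (metis negligible_iff_null_sets null_sets_completion_iff)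
    then show "AE z in lborel. z \<bullet> b \<noteq> 0"
      by (rule AE_I') (auto simp: inner_commute)
  qed simp
  have "(\<integral>\<^sup>+z. ennreal (indicator (cball 0 1) (z::'a) * norm z powr \<gamma>) \<partial>lborel) \<le>
      (\<integral>\<^sup>+z. (\<Prod>b\<in>Basis. ennreal (indicator {-1..1} ((z::'a) \<bullet> b) * \<bar>z \<bullet> b\<bar> powr \<alpha>)) \<partial>lborel)"
  proof (rule nn_integral_mono_AE, use null in eventually_elim)
    fix z :: 'a assume z: "\<forall>b\<in>Basis. z \<bullet> b \<noteq> 0"
    have "indicator (cball 0 1) z * norm z powr \<gamma> \<le>
        (\<Prod>b\<in>Basis. indicator {-1..1} (z \<bullet> b) * \<bar>z \<bullet> b\<bar> powr \<alpha>)"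
    proof (cases "norm z \<le> 1")
      case True
      have le: "\<bar>z \<bullet> b\<bar> \<le> norm z" if "b \<in> Basis" for b
        using Basis_le_norm[OF that] .
      have "z \<noteq> 0" using z by auto
      then have "norm z powr \<gamma> = (\<Prod>b\<in>(Basis::'a set). norm z powr \<alpha>)"
        by (simp add: \<alpha>_def powr_powr powr_realpow[symmetric])
      also have "\<dots> \<le> (\<Prod>b\<in>Basis. \<bar>z \<bullet> b\<bar> powr \<alpha>)"
        using z le \<alpha> by (intro prod_mono conjI powr_mono2') auto
      also have "\<dots> = (\<Prod>b\<in>Basis. indicator {-1..1} (z \<bullet> b) * \<bar>z \<bullet> b\<bar> powr \<alpha>)"
        using le True by (intro prod.cong refl) (force simp: indicator_def)
      finally show ?thesis using True by simp
    qed (auto intro!: prod_nonneg)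
    then show "ennreal (indicator (cball 0 1) z * norm z powr \<gamma>) \<le>
        (\<Prod>b\<in>Basis. ennreal (indicator {-1..1} (z \<bullet> b) * \<bar>z \<bullet> b\<bar> powr \<alpha>))"
      by (subst prod_ennreal) (auto intro: ennreal_leI)
  qed
  also have "\<dots> < \<infinity>"
    using nn_integral_powr_near_0_finite[OF \<alpha>(1)]
    by (subst nn_integral_lborel_prod) (auto simp: power_less_top_ennreal)
  finally show ?thesis .
qed

lemma nn_integral_lborel_reflect:
  fixes f :: "'a::euclidean_space \<Rightarrow> ennreal"
  assumes [measurable]: "f \<in> borel_measurable borel"
  shows "(\<integral>\<^sup>+w. f (v - w) \<partial>lborel) = (\<integral>\<^sup>+w. f w \<partial>lborel)"
  by (subst lborel_affine[of "-1" v])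
     (simp_all add: nn_integral_density nn_integral_distr)

text \<open>Uniformity in \<open>v\<close> comes from splitting at |v - w| = 1: inside, the Gaussian
  is at most 1 and the integral of the power does not depend on \<open>v\<close>; outside, the power
  is at most 1 because \<gamma> \<le> 0.\<close>

lemma nn_integral_gaussian_powr_bounded:
  fixes c :: "'a::euclidean_space"
  assumes "0 < \<delta>" "- real DIM('a) < \<gamma>" "\<gamma> \<le> 0"
  obtains C :: ennreal where "C < \<infinity>"
    "\<And>v. (\<integral>\<^sup>+w. ennreal (exp (- \<delta> * (norm (w - c))\<^sup>2) * norm (v - w) powr \<gamma>) \<partial>lborel) \<le> C"
proof
  let ?G = "\<integral>\<^sup>+w. ennreal (exp (- \<delta> * (norm (w - c))\<^sup>2)) \<partial>lborel"
  let ?P = "\<integral>\<^sup>+z. ennreal (indicator (cball 0 1) (z::'a) * norm z powr \<gamma>) \<partial>lborel"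
  show "?G + ?P < \<infinity>"
    using nn_integral_gaussian_finite[OF assms(1), of c] nn_integral_norm_powr_ball_finite[OF assms(2,3)]
    by simp
  fix v
  have ball [measurable]: "cball (0::'a) 1 \<in> sets borel" by simp
  have "exp (- \<delta> * (norm (w - c))\<^sup>2) * norm (v - w) powr \<gamma> \<le>
      exp (- \<delta> * (norm (w - c))\<^sup>2) + indicator (cball 0 1) (v - w) * norm (v - w) powr \<gamma>" for w
  proof (cases "norm (v - w) \<le> 1")
    case True
    then show ?thesis
      using assms(1) by (simp add: mult_left_le_one_le add_increasing)
  next
    case False
    then have "norm (v - w) powr \<gamma> \<le> 1"
      using powr_mono[of \<gamma> 0 "norm (v - w)"] assms(3) by (cases "v = w") auto
    then show ?thesis
      using False by (simp add: mult_left_le)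
  qed
  then have "(\<integral>\<^sup>+w. ennreal (exp (- \<delta> * (norm (w - c))\<^sup>2) * norm (v - w) powr \<gamma>) \<partial>lborel) \<le>
     (\<integral>\<^sup>+w. ennreal (exp (- \<delta> * (norm (w - c))\<^sup>2)) +
        ennreal (indicator (cball 0 1) (v - w) * norm (v - w) powr \<gamma>) \<partial>lborel)"
    by (intro nn_integral_mono) (simp flip: ennreal_plus add: ennreal_leI)
  also have "\<dots> = ?G + ?P"
    using ball
    by (subst nn_integral_add)
       (simp_all add: nn_integral_lborel_reflect[of "\<lambda>z. ennreal (indicator (cball 0 1) z * norm z powr \<gamma>)"])
  finally show "(\<integral>\<^sup>+w. ennreal (exp (- \<delta> * (norm (w - c))\<^sup>2) * norm (v - w) powr \<gamma>) \<partial>lborel) \<le> ?G + ?P" .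
qed

text \<open>Only the component of y + s z along \<open>z\<close> is kept. It is affine in
  \<open>s\<close> with slope |z|, which produces the factor 1/|z| and removes the dependence on
  \<open>y\<close>.\<close>

lemma nn_integral_gaussian_line_le:
  fixes y z :: "'a::euclidean_space"
  assumes "0 < \<delta>" "z \<noteq> 0"
  shows "(\<integral>\<^sup>+s. ennreal (exp (- \<delta> * (norm (y + s *\<^sub>R z))\<^sup>2)) \<partial>lborel) \<le>
    ennreal (1 / norm z) * (\<integral>\<^sup>+u. ennreal (exp (- \<delta> * u\<^sup>2)) \<partial>lborel)"
proof -
  define k where "k = y \<bullet> z / norm z"
  have nz: "norm z > 0" using assms by simp
  have "(k + norm z * s)\<^sup>2 \<le> (norm (y + s *\<^sub>R z))\<^sup>2" for s
  proof -
    have "k + norm z * s = (y + s *\<^sub>R z) \<bullet> z / norm z"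
      using nz by (simp add: k_def inner_add_left add_divide_distrib dot_square_norm power2_eq_square)
    then have "\<bar>k + norm z * s\<bar> \<le> norm (y + s *\<^sub>R z)"
      using Cauchy_Schwarz_ineq2[of "y + s *\<^sub>R z" z] nz by (simp add: pos_divide_le_eq)
    then show ?thesis
      by (metis abs_le_square_iff abs_norm_cancel)
  qed
  then have "(\<integral>\<^sup>+s. ennreal (exp (- \<delta> * (norm (y + s *\<^sub>R z))\<^sup>2)) \<partial>lborel) \<le>
     (\<integral>\<^sup>+s. ennreal (exp (- \<delta> * (k + norm z * s)\<^sup>2)) \<partial>lborel)"
    using assms(1) by (intro nn_integral_mono ennreal_leI) simp
  also have "\<dots> = ennreal (1 / norm z) * (\<integral>\<^sup>+u. ennreal (exp (- \<delta> * u\<^sup>2)) \<partial>lborel)"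
    by (subst (2) nn_integral_real_affine[where c = "norm z" and t = k])
       (use nz in \<open>simp_all flip: mult.assoc ennreal_mult\<close>)
  finally show ?thesis .
qed

text \<open>
  Integrating in \<open>s\<close> first costs a factor \<open>1/|v - w|\<close>, which lowers the exponent to
  \<open>\<beta> - 1 > - D\<close>.
\<close>

lemma nn_integral_gaussian_characteristic_bounded:
  fixes c :: "'a::euclidean_space"
  assumes "0 < \<delta>" "1 - real DIM('a) < \<beta>" "\<beta> \<le> 1"
  obtains C :: ennreal where "C < \<infinity>"
    "\<And>v y. (\<integral>\<^sup>+s. \<integral>\<^sup>+w. ennreal (exp (- \<delta> * ((norm (w - c))\<^sup>2 + (norm (y + s *\<^sub>R (v - w)))\<^sup>2)) *
        norm (v - w) powr \<beta>) \<partial>lborel \<partial>lborel) \<le> C"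
proof -
  obtain C where C: "C < \<infinity>"
    "\<And>v. (\<integral>\<^sup>+w. ennreal (exp (- \<delta> * (norm (w - c))\<^sup>2) * norm (v - w) powr (\<beta> - 1)) \<partial>lborel) \<le> C"
    using nn_integral_gaussian_powr_bounded[of \<delta> "\<beta> - 1" c] assms by auto
  define G where "G = (\<integral>\<^sup>+u. ennreal (exp (- \<delta> * u\<^sup>2)) \<partial>lborel)"
  have G: "G < \<infinity>"
    using nn_integral_exp_neg_square_finite[OF assms(1), of 0] by (simp add: G_def)
  show ?thesis
  proof (rule that[of "C * G"])
    show "C * G < \<infinity>" using C(1) G by (simp add: ennreal_mult_less_top)
    fix v y :: 'a
    let ?g = "\<lambda>w. exp (- \<delta> * (norm (w - c))\<^sup>2)"
    have split: "ennreal (exp (- \<delta> * ((norm (w - c))\<^sup>2 + (norm (y + s *\<^sub>R (v - w)))\<^sup>2)) * norm (v - w) powr \<beta>) =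
       ennreal (?g w * norm (v - w) powr \<beta>) * ennreal (exp (- \<delta> * (norm (y + s *\<^sub>R (v - w)))\<^sup>2))" for s w
      by (simp add: exp_add ring_distribs flip: ennreal_mult) (simp add: mult_exp_exp)
    have "(\<integral>\<^sup>+s. \<integral>\<^sup>+w. ennreal (exp (- \<delta> * ((norm (w - c))\<^sup>2 + (norm (y + s *\<^sub>R (v - w)))\<^sup>2)) *
        norm (v - w) powr \<beta>) \<partial>lborel \<partial>lborel) =
      (\<integral>\<^sup>+w. ennreal (?g w * norm (v - w) powr \<beta>) *
         (\<integral>\<^sup>+s. ennreal (exp (- \<delta> * (norm (y + s *\<^sub>R (v - w)))\<^sup>2)) \<partial>lborel) \<partial>lborel)"
      unfolding split
      by (subst lborel_pair.Fubini') (simp_all add: nn_integral_cmult)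
    also have "\<dots> \<le> (\<integral>\<^sup>+w. ennreal (?g w * norm (v - w) powr (\<beta> - 1)) * G \<partial>lborel)"
    proof (rule nn_integral_mono)
      fix w
      show "ennreal (?g w * norm (v - w) powr \<beta>) *
         (\<integral>\<^sup>+s. ennreal (exp (- \<delta> * (norm (y + s *\<^sub>R (v - w)))\<^sup>2)) \<partial>lborel) \<le>
         ennreal (?g w * norm (v - w) powr (\<beta> - 1)) * G"
      \<comment> \<open>On the diagonal the \<open>s\<close>-integral is infinite, but
        \<open>0 powr \<beta> = 0\<close>, and 0 times infinity is 0 in
        \<open>ennreal\<close>.\<close>
      proof (cases "v = w")
        case False
        have "ennreal (?g w * norm (v - w) powr \<beta>) *
           (\<integral>\<^sup>+s. ennreal (exp (- \<delta> * (norm (y + s *\<^sub>R (v - w)))\<^sup>2)) \<partial>lborel) \<le>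
           ennreal (?g w * norm (v - w) powr \<beta>) * (ennreal (1 / norm (v - w)) * G)"
          using False assms(1) unfolding G_def
          by (intro mult_left_mono nn_integral_gaussian_line_le) auto
        also have "\<dots> = ennreal (?g w * norm (v - w) powr (\<beta> - 1)) * G"
          using False by (simp add: powr_diff flip: mult.assoc ennreal_mult)
        finally show ?thesis .
      qed simp
    qed
    also have "\<dots> = (\<integral>\<^sup>+w. ennreal (?g w * norm (v - w) powr (\<beta> - 1)) \<partial>lborel) * G"
      by (rule nn_integral_multc) simp
    also have "\<dots> \<le> C * G"
      using C(2) by (intro mult_right_mono) auto
    finally show "(\<integral>\<^sup>+s. \<integral>\<^sup>+w. ennreal (exp (- \<delta> * ((norm (w - c))\<^sup>2 + (norm (y + s *\<^sub>R (v - w)))\<^sup>2)) *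
        norm (v - w) powr \<beta>) \<partial>lborel \<partial>lborel) \<le> C * G" .
  qed
qed

section \<open>Global Maxwellians\<close>

text \<open>The segment from the identity to \<open>A\<close> consists of positive definite, hence
  invertible matrices, so the determinant cannot reach 0 along it. Applied to
  \<open>maxwellian_matrix\<close>, this makes the prefactor of a Maxwellian positive.\<close>

lemma det_pos_if_positive_definite:
  fixes A :: "real^'n^'n"
  assumes "\<And>u. u \<noteq> 0 \<Longrightarrow> 0 < u \<bullet> (A *v u)"
  shows "0 < det A"
proof (rule ccontr)
  assume "\<not> 0 < det A"
  define h where "h t = det ((1 - t) *\<^sub>R mat 1 + t *\<^sub>R A)" for t :: real
  have "continuous_on {0..1} h"
    unfolding h_def det_def by (intro continuous_intros)
  moreover have "h 0 = 1" "h 1 = det A"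
    by (simp_all add: h_def)
  ultimately obtain t where t: "0 \<le> t" "t \<le> 1" "h t = 0"
    using IVT2'[of h 1 0 0] \<open>\<not> 0 < det A\<close> by auto
  let ?C = "(1 - t) *\<^sub>R mat 1 + t *\<^sub>R A"
  have "\<not> invertible ?C"
    using t by (simp add: invertible_det_nz h_def)
  then obtain u where u: "u \<noteq> 0" "?C *v u = 0"
    using invertible_left_inverse[of ?C] matrix_left_invertible_ker[of ?C] by auto
  have "0 = u \<bullet> (?C *v u)" using u by simp
  also have "\<dots> = (1 - t) * (u \<bullet> u) + t * (u \<bullet> (A *v u))"
    by (simp add: matrix_vector_mult_add_rdistrib scaleR_matrix_vector_assoc[symmetric] inner_add_right)
  also have "\<dots> > 0"
  proof (cases "t = 0")
    case False
    then have "0 < t * (u \<bullet> (A *v u))" using t assms[OF u(1)] by simp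
    moreover have "0 \<le> (1 - t) * (u \<bullet> u)" using t by simp
    ultimately show ?thesis by linarith
  qed (use u in simp)
  finally show False by simp
qed

lemma skew_matrix_inner:
  fixes B :: "real^'n^'n"
  assumes "transpose B = - B"
  shows "(B *v u) \<bullet> y = - (u \<bullet> (B *v y))"
proof -
  have "u \<bullet> (B *v y) = (transpose B *v u) \<bullet> y"
    by (metis dot_lmul_matrix transpose_matrix_vector)
  also have "(transpose B *v u) = - (B *v u)"
    unfolding assms by (simp add: vec_eq_iff matrix_vector_mult_def sum_negf)
  finally show ?thesis by simp
qed

lemma skew_matrix_inner_self:
  fixes B :: "real^'n^'n"
  assumes "transpose B = - B"
  shows "u \<bullet> (B *v u) = 0"
  using skew_matrix_inner[OF assms, of u u] by (simp add: inner_commute)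

text \<open>Completing the square in \<open>y\<close> leaves the matrix \<open>Q\<close> as the form in \<open>u\<close>.\<close>

lemma maxwellian_form_complete_square:
  fixes B :: "real^'n^'n"
  assumes "transpose B = - B"
  shows "2 * a * maxwellian_form a b c B u y 0 =
    (norm (a *\<^sub>R y + b *\<^sub>R u + B *v u))\<^sup>2 + u \<bullet> (maxwellian_matrix a b c B *v u)"
proof -
  have sk: "(B *v u) \<bullet> z = - (u \<bullet> (B *v z))" for z u
    by (rule skew_matrix_inner[OF assms])
  have "mat (a * c - b\<^sup>2) *v u = (a * c - b\<^sup>2) *\<^sub>R u"
    by (simp add: vec_eq_iff matrix_vector_mult_def mat_def if_distrib[where f = "\<lambda>z. z * _"] cong: if_cong)
  then have Q: "u \<bullet> (maxwellian_matrix a b c B *v u) = (a * c - b\<^sup>2) * (u \<bullet> u) + u \<bullet> (B *v (B *v u))"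
    by (simp add: maxwellian_matrix_def matrix_vector_mult_add_rdistrib matrix_vector_mul_assoc inner_add_right)
  have "(norm (a *\<^sub>R y + b *\<^sub>R u + z))\<^sup>2 =
      a\<^sup>2 * (y \<bullet> y) + b\<^sup>2 * (u \<bullet> u) + z \<bullet> z + 2 * a * b * (y \<bullet> u) + 2 * a * (z \<bullet> y) + 2 * b * (u \<bullet> z)"
    for z :: "real^'n"
    unfolding power2_norm_eq_inner
    by (simp add: inner_add_left inner_add_right inner_commute power2_eq_square algebra_simps)
  then show ?thesis
    unfolding Q maxwellian_form_def
    using sk[of u "B *v u"]
    by (simp add: sk skew_matrix_inner_self[OF assms] power2_norm_eq_inner algebra_simps)
      (simp add: power2_eq_square sk inner_commute[of y u] inner_commute[of y "B *v u"])
qed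

text \<open>By the completed square the form is positive away from the origin of the joint (u, y)
  space, and it is homogeneous of degree 2; its minimum on the compact unit sphere serves as
  \<delta>.\<close>

lemma maxwellian_form_coercive:
  fixes B :: "real^'n^'n"
  assumes "0 < a" "transpose B = - B"
    and "\<And>u. u \<noteq> 0 \<Longrightarrow> 0 < u \<bullet> (maxwellian_matrix a b c B *v u)"
  obtains \<delta> where "0 < \<delta>"
    "\<And>u y. \<delta> * ((norm u)\<^sup>2 + (norm y)\<^sup>2) \<le> maxwellian_form a b c B u y 0"
proof -
  define f where "f p = maxwellian_form a b c B (fst p) (snd p) 0" for p :: "(real^'n) \<times> (real^'n)"
  have pos: "0 < f p" if "p \<noteq> 0" for p
  proof -
    obtain u y where p: "p = (u, y)" by fastforce
    have "0 < 2 * a * maxwellian_form a b c B u y 0"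
    proof (cases "u = 0")
      case True
      then show ?thesis
        unfolding maxwellian_form_complete_square[OF assms(2)] using that p assms(1) by (simp add: zero_prod_def)
    next
      case False
      then show ?thesis
        unfolding maxwellian_form_complete_square[OF assms(2)]
        using assms(3)[of u] by (simp add: add_nonneg_pos)
    qed
    then show ?thesis
      using assms(1) by (simp add: f_def p zero_less_mult_iff)
  qed
  have "continuous_on (sphere 0 1) f"
    unfolding f_def maxwellian_form_def
    by (intro continuous_intros continuous_on_compose2[OF matrix_vector_mult_linear_continuous_on]) auto
  moreover have "sphere (0::(real^'n) \<times> (real^'n)) 1 \<noteq> {}" by simp
  ultimately obtain p0 where p0: "p0 \<in> sphere 0 1" "\<And>p. p \<in> sphere 0 1 \<Longrightarrow> f p0 \<le> f p"
    using continuous_attains_inf[OF compact_sphere] by metis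
  show ?thesis
  proof (rule that)
    show "0 < f p0" using p0(1) by (intro pos) auto
    fix u y :: "real^'n"
    show "f p0 * ((norm u)\<^sup>2 + (norm y)\<^sup>2) \<le> maxwellian_form a b c B u y 0"
    proof (cases "(u, y) = 0")
      case True
      then show ?thesis by (simp add: maxwellian_form_def zero_prod_def)
    next
      case False
      define k where "k = norm (u, y)"
      have k: "k > 0" "k\<^sup>2 = (norm u)\<^sup>2 + (norm y)\<^sup>2"
        using False by (simp_all only: k_def zero_less_norm_iff not_False_eq_True) (simp add: norm_Pair)
      have "f p0 \<le> f ((1/k) *\<^sub>R (u, y))"
        using k(1) by (intro p0(2)) (simp add: k_def del: scaleR_Pair)
      also have "\<dots> = (1/k)\<^sup>2 * maxwellian_form a b c B u y 0"
        by (simp add: f_def maxwellian_form_def matrix_vector_mult_scaleR power2_eq_square algebra_simps)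
      finally show ?thesis
        unfolding k(2)[symmetric] using k(1) by (simp add: field_simps)
    qed
  qed
qed

lemma maxwellian_form_shift:
  "maxwellian_form a b c B u y t = maxwellian_form a b c B u (y - t *\<^sub>R u) 0"
  by (simp add: maxwellian_form_def)

lemma global_maxwellian_pos:
  fixes M :: "(real^'n) \<times> (real^'n) \<times> real \<Rightarrow> real"
  assumes "global_maxwellian M"
  shows "0 < M p"
  using assms det_pos_if_positive_definite
  by (cases p) (fastforce simp: global_maxwellian_def)

lemma global_maxwellian_measurable:
  fixes M :: "(real^'n) \<times> (real^'n) \<times> real \<Rightarrow> real"
  assumes "global_maxwellian M"
  shows "M \<in> borel_measurable borel"
proof -
  obtain k a b c v0 x0 B where M: "M = (\<lambda>(v, x, t). k *
      exp (- maxwellian_form a b c B (v - v0) (x - x0 - t *\<^sub>R v0) t))"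
    using assms unfolding global_maxwellian_def by blast
  have "continuous_on UNIV (\<lambda>p. maxwellian_form a b c B (fst p - v0) (fst (snd p) - x0 - snd (snd p) *\<^sub>R v0) (snd (snd p)))"
    unfolding maxwellian_form_def
    by (intro continuous_intros continuous_on_compose2[OF matrix_vector_mult_linear_continuous_on]) auto
  then have "continuous_on UNIV M"
    unfolding M case_prod_beta by (intro continuous_intros)
  then show ?thesis by (rule borel_measurable_continuous_onI)
qed

lemma global_maxwellian_gaussian_bound:
  fixes M :: "(real^'n) \<times> (real^'n) \<times> real \<Rightarrow> real"
  assumes "global_maxwellian M"
  obtains K \<delta> v0 x0 where "0 < K" "0 < \<delta>"
    "\<And>v x t. M (v, x, t) \<le> K * exp (- \<delta> * ((norm (v - v0))\<^sup>2 + (norm (x - x0 - t *\<^sub>R v))\<^sup>2))"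
proof -
  obtain m a b c v0 x0 B where par: "0 < m" "0 < a" "transpose B = - B"
      "\<And>u. u \<noteq> 0 \<Longrightarrow> 0 < u \<bullet> (maxwellian_matrix a b c B *v u)"
    and M: "M = (\<lambda>(v, x, t). m / (2 * pi) ^ CARD('n) * sqrt (det (maxwellian_matrix a b c B)) *
               exp (- maxwellian_form a b c B (v - v0) (x - x0 - t *\<^sub>R v0) t))"
    using assms unfolding global_maxwellian_def by blast
  obtain \<delta> where \<delta>: "0 < \<delta>"
    "\<And>u y. \<delta> * ((norm u)\<^sup>2 + (norm y)\<^sup>2) \<le> maxwellian_form a b c B u y 0"
    using maxwellian_form_coercive[OF par(2-4)] by blast
  let ?K = "m / (2 * pi) ^ CARD('n) * sqrt (det (maxwellian_matrix a b c B))"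
  have K: "0 < ?K"
    using par det_pos_if_positive_definite[OF par(4)] by simp
  \<comment> \<open>The boost cancels in the transported position: (x - x0 - t v0) - t (v - v0) = x
    - x0 - t v.\<close>
  have "\<delta> * ((norm (v - v0))\<^sup>2 + (norm (x - x0 - t *\<^sub>R v))\<^sup>2) \<le>
      maxwellian_form a b c B (v - v0) (x - x0 - t *\<^sub>R v0) t" for v x t
    using \<delta>(2)[of "v - v0" "x - x0 - t *\<^sub>R v"]
    by (subst maxwellian_form_shift) (simp add: algebra_simps)
  then show ?thesis
    using K \<delta>(1) mult_left_mono[OF _ less_imp_le[OF K]]
    by (intro that[of ?K \<delta> v0 x0]) (simp_all only: M prod.case mult_minus_left neg_le_iff_le exp_le_cancel_iff)
qed

text \<open>Since \<open>B\<close> is skew, the exponent is an isotropic quadratic polynomial of the velocity.\<close>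

lemma maxwellian_form_isotropic:
  fixes B :: "real^'n^'n"
  assumes "transpose B = - B"
  shows "maxwellian_form a b c B u y t =
    (c + a * t\<^sup>2 - 2 * b * t) / 2 * (u \<bullet> u) + u \<bullet> ((b - a * t) *\<^sub>R y - B *v y) + a / 2 * (y \<bullet> y)"
  unfolding maxwellian_form_def power2_norm_eq_inner
  using skew_matrix_inner_self[OF assms, of u]
  by (simp add: matrix_vector_mult_diff_distrib matrix_vector_mult_scaleR inner_diff_left inner_diff_right
      inner_add_right inner_commute[of y u] power2_eq_square field_simps)

lemma post_velocities_conservation:
  fixes v w \<omega> :: "real^'n"
  assumes "norm \<omega> = 1"
  shows "post_v v w \<omega> + post_w v w \<omega> = v + w"
    and "post_v v w \<omega> \<bullet> post_v v w \<omega> + post_w v w \<omega> \<bullet> post_w v w \<omega> = v \<bullet> v + w \<bullet> w"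
proof -
  have 1: "\<omega> \<bullet> \<omega> = 1" using assms by (simp add: norm_eq_1)
  show "post_v v w \<omega> + post_w v w \<omega> = v + w"
    by (simp add: post_v_def post_w_def)
  show "post_v v w \<omega> \<bullet> post_v v w \<omega> + post_w v w \<omega> \<bullet> post_w v w \<omega> = v \<bullet> v + w \<bullet> w"
    unfolding post_v_def post_w_def using 1
    by (simp add: inner_add_left inner_add_right inner_diff_left inner_diff_right inner_commute algebra_simps)
qed

text \<open>At fixed (x, t) the exponent is a combination of the collision invariants: 1, the
  velocity and its squared norm. The sum over the two particles is therefore unchanged.\<close>

lemma global_maxwellian_collision:
  fixes M :: "(real^'n) \<times> (real^'n) \<times> real \<Rightarrow> real"
  assumes "global_maxwellian M" "norm \<omega> = 1"
  shows "M (post_v v w \<omega>, x, t) * M (post_w v w \<omega>, x, t) = M (v, x, t) * M (w, x, t)"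
proof -
  obtain k a b c v0 x0 B where B: "transpose B = - B"
    and M: "M = (\<lambda>(v, x, t). k * exp (- maxwellian_form a b c B (v - v0) (x - x0 - t *\<^sub>R v0) t))"
    using assms(1) unfolding global_maxwellian_def by blast
  define y where "y = x - x0 - t *\<^sub>R v0"
  let ?f = "\<lambda>v. maxwellian_form a b c B (v - v0) y t"
  \<comment> \<open>Collisions commute with the shift by \<open>v0\<close>, since only the relative
    velocity enters the exchange.\<close>
  have 1: "post_v v w \<omega> - v0 = post_v (v - v0) (w - v0) \<omega>" "post_w v w \<omega> - v0 = post_w (v - v0) (w - v0) \<omega>"
    by (simp_all add: post_v_def post_w_def)
  have "?f (post_v v w \<omega>) + ?f (post_w v w \<omega>) = ?f v + ?f w"
  proof -
    have comb: "\<alpha> * A1 + r1 \<bullet> \<xi> + \<kappa> + (\<alpha> * A2 + r2 \<bullet> \<xi> + \<kappa>) = \<alpha> * (A1 + A2) + (r1 + r2) \<bullet> \<xi> + 2 * \<kappa>"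
      for \<alpha> A1 A2 \<kappa> :: real and r1 r2 \<xi> :: "real^'n"
      by (simp add: algebra_simps)
    show ?thesis
      unfolding 1 maxwellian_form_isotropic[OF B] comb post_velocities_conservation[OF assms(2)] by simp
  qed
  then have "exp (- ?f (post_v v w \<omega>)) * exp (- ?f (post_w v w \<omega>)) = exp (- ?f v) * exp (- ?f w)"
    by (simp flip: exp_add)
  then show ?thesis by (simp add: M y_def)
qed

section \<open>Orthogonal invariance and the surface measure\<close>

lemma ball_in_borel [measurable]: "ball a r \<in> sets borel"
  by simp

lemma nn_integral_lborel_translate:
  fixes f :: "'a::euclidean_space \<Rightarrow> ennreal"
  assumes [measurable]: "f \<in> borel_measurable borel"
  shows "(\<integral>\<^sup>+w. f (w + c) \<partial>lborel) = (\<integral>\<^sup>+w. f w \<partial>lborel)"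
  by (subst (2) lborel_distr_plus[of c, symmetric]) (simp add: nn_integral_distr add.commute)

lemma orthogonal_transformation_measurable:
  fixes R :: "'a::euclidean_space \<Rightarrow> 'a"
  assumes "orthogonal_transformation R"
  shows "R \<in> borel_measurable borel"
  using assms by (intro borel_measurable_continuous_onI linear_continuous_on
      linear_conv_bounded_linear[THEN iffD1] orthogonal_transformation_linear)

text \<open>
  Uniqueness of Haar measure: the double integral of \<open>f (x + R y) g y\<close>, with \<open>g\<close> the indicator
  of the unit ball, is evaluated in both orders using translation invariance only. The version in
  \<open>HOL-Analysis.Change_Of_Vars\<close> needs a well-ordered index type.
\<close>

lemma nn_integral_lborel_orthogonal:
  fixes R :: "'a::euclidean_space \<Rightarrow> 'a"
  assumes R: "orthogonal_transformation R" and [measurable]: "f \<in> borel_measurable borel"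
  shows "(\<integral>\<^sup>+y. f (R y) \<partial>lborel) = (\<integral>\<^sup>+y. f y \<partial>lborel)"
proof -
  define S where "S = inv R"
  have S: "orthogonal_transformation S"
    using R by (simp add: S_def orthogonal_transformation_inv)
  have RS: "R (S x) = x" for x
    using R by (simp add: S_def surj_f_inv_f orthogonal_transformation_surj)
  have diff: "R (x - y) = R x - R y" for x y
    using R by (simp add: linear_diff orthogonal_transformation_linear)
  have [measurable]: "R \<in> borel_measurable borel" "S \<in> borel_measurable borel"
    using R S by (auto intro: orthogonal_transformation_measurable)
  define g :: "'a \<Rightarrow> ennreal" where "g = indicator (ball 0 1)"
  have [measurable]: "g \<in> borel_measurable borel"
    unfolding g_def by measurable
  \<comment> \<open>This factor is cancelled at the end, so it must be neither 0 nor
    infinite.\<close>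
  have g_int: "(\<integral>\<^sup>+y. g y \<partial>lborel) \<noteq> 0" "(\<integral>\<^sup>+y. g y \<partial>lborel) < top"
    by (simp_all add: g_def emeasure_ball less_imp_neq[THEN not_sym])
  have gR: "g (y - S x) = g (R y - x)" for x y
    using orthogonal_transformation_norm[OF R, of "y - S x"]
    by (simp add: g_def indicator_def diff RS)
  have "(\<integral>\<^sup>+y. g y \<partial>lborel) * (\<integral>\<^sup>+x. f x \<partial>lborel) = (\<integral>\<^sup>+y. \<integral>\<^sup>+x. g y * f (x + R y) \<partial>lborel \<partial>lborel)"
    by (simp add: nn_integral_cmult nn_integral_multc nn_integral_lborel_translate)
  also have "\<dots> = (\<integral>\<^sup>+x. \<integral>\<^sup>+y. g y * f (x + R y) \<partial>lborel \<partial>lborel)"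
    by (rule lborel_pair.Fubini') simp
  also have "\<dots> = (\<integral>\<^sup>+x. \<integral>\<^sup>+y. g (R y - x) * f (R y) \<partial>lborel \<partial>lborel)"
  proof (rule nn_integral_cong)
    fix x
    show "(\<integral>\<^sup>+y. g y * f (x + R y) \<partial>lborel) = (\<integral>\<^sup>+y. g (R y - x) * f (R y) \<partial>lborel)"
      \<comment> \<open>Shifting \<open>y\<close> by - S x turns f (x + R y) into f (R y), and
        \<open>gR\<close> rewrites g (y - S x) because R is an isometry.\<close>
      using nn_integral_lborel_translate[of "\<lambda>y. g y * f (x + R y)" "- S x"]
      by (simp add: diff RS gR)
  qed
  also have "\<dots> = (\<integral>\<^sup>+y. \<integral>\<^sup>+x. g (R y - x) * f (R y) \<partial>lborel \<partial>lborel)"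
    by (rule lborel_pair.Fubini') simp
  also have "\<dots> = (\<integral>\<^sup>+y. (\<integral>\<^sup>+x. g x \<partial>lborel) * f (R y) \<partial>lborel)"
    by (simp add: nn_integral_multc nn_integral_lborel_reflect)
  also have "\<dots> = (\<integral>\<^sup>+x. g x \<partial>lborel) * (\<integral>\<^sup>+y. f (R y) \<partial>lborel)"
    by (rule nn_integral_cmult) simp
  finally show ?thesis
    using g_int by (auto simp: ennreal_mult_cancel_left)
qed

lemma AE_lborel_orthogonal:
  fixes R :: "'a::euclidean_space \<Rightarrow> 'a"
  assumes R: "orthogonal_transformation R" and [measurable]: "Measurable.pred borel P"
    and "AE y in lborel. P y"
  shows "AE y in lborel. P (R y)"
proof -
  have [measurable]: "R \<in> borel_measurable borel"
    using R by (rule orthogonal_transformation_measurable)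
  have "(\<integral>\<^sup>+y. of_bool (\<not> P y) \<partial>lborel) = 0"
    using assms(3) by (subst nn_integral_0_iff_AE) auto
  then have "(\<integral>\<^sup>+y. of_bool (\<not> P (R y)) \<partial>lborel) = 0"
    using nn_integral_lborel_orthogonal[OF R, of "\<lambda>y. of_bool (\<not> P y)"] by simp
  then show ?thesis
    by (subst (asm) nn_integral_0_iff_AE) auto
qed

section \<open>Surface measure, its invariance and the angular mass\<close>

lemma sgn_borel_measurable [measurable]:
  "(sgn :: 'a::euclidean_space \<Rightarrow> 'a) \<in> borel_measurable borel"
  unfolding sgn_div_norm by measurable

lemma sets_sphere_measure [simp, measurable_cong]: "sets sphere_measure = sets borel"
  by (simp add: sphere_measure_def)

lemma space_sphere_measure [simp]: "space sphere_measure = UNIV"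
  by (simp add: sphere_measure_def)

lemma nn_integral_sphere_measure:
  fixes f :: "real^'n \<Rightarrow> ennreal"
  assumes [measurable]: "f \<in> borel_measurable borel"
  shows "(\<integral>\<^sup>+\<omega>. f \<omega> \<partial>sphere_measure) =
    (\<integral>\<^sup>+x. of_nat CARD('n) * indicator (ball 0 1) x * f (sgn x) \<partial>lborel)"
  unfolding sphere_measure_def
  by (subst nn_integral_distr, simp_all, subst nn_integral_density) simp_all

lemma finite_measure_sphere_measure: "finite_measure (sphere_measure :: (real^'n) measure)"
proof
  have "emeasure sphere_measure (UNIV :: (real^'n) set) =
      (\<integral>\<^sup>+x. of_nat CARD('n) * indicator (ball (0::real^'n) 1) x \<partial>lborel)"
    using nn_integral_sphere_measure[of "\<lambda>_::real^'n. 1"] by simp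
  also have "\<dots> = of_nat CARD('n) * emeasure lborel (ball (0::real^'n) 1)"
    by (subst nn_integral_cmult) auto
  also have "\<dots> < top"
    by (simp add: emeasure_ball ennreal_mult_less_top of_nat_less_top)
  finally show "emeasure sphere_measure (space (sphere_measure :: (real^'n) measure)) \<noteq> \<infinity>"
    by simp
qed

text \<open>The origin is the only point that \<open>sgn\<close> does not send to the sphere, and it
  is Lebesgue null.\<close>

lemma AE_sphere_measure_norm: "AE \<omega> in (sphere_measure :: (real^'n) measure). norm \<omega> = 1"
proof -
  have "AE x in lborel. norm (sgn x :: real^'n) = 1"
    using AE_lborel_singleton[of "0 :: real^'n"] by eventually_elim (simp add: norm_sgn)
  then show ?thesis
    unfolding sphere_measure_def
    by (subst AE_distr_iff, measurable, subst AE_density, measurable) (auto elim: eventually_mono)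
qed

text \<open>A linear isometry commutes with \<open>sgn\<close> and preserves the unit ball, so the
  invariance of Lebesgue measure passes to the push-forward.\<close>

lemma nn_integral_sphere_measure_orthogonal:
  fixes R :: "real^'n \<Rightarrow> real^'n"
  assumes R: "orthogonal_transformation R" and [measurable]: "f \<in> borel_measurable borel"
  shows "(\<integral>\<^sup>+\<omega>. f (R \<omega>) \<partial>sphere_measure) = (\<integral>\<^sup>+\<omega>. f \<omega> \<partial>sphere_measure)"
proof -
  have [measurable]: "R \<in> borel_measurable borel"
    using R by (rule orthogonal_transformation_measurable)
  have "R (sgn x) = sgn (R x)" "indicator (ball 0 1) x = (indicator (ball 0 1) (R x) :: ennreal)" for x
    using R by (simp_all add: sgn_div_norm orthogonal_transformation_norm linear_cmul
        orthogonal_transformation_linear indicator_def)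
  then have "(\<integral>\<^sup>+\<omega>. f (R \<omega>) \<partial>sphere_measure) =
      (\<integral>\<^sup>+x. of_nat CARD('n) * indicator (ball 0 1) (R x) * f (sgn (R x)) \<partial>lborel)"
    by (simp add: nn_integral_sphere_measure)
  also have "\<dots> = (\<integral>\<^sup>+\<omega>. f \<omega> \<partial>sphere_measure)"
    by (subst nn_integral_lborel_orthogonal[OF R, where f = "\<lambda>x. of_nat CARD('n) * indicator (ball 0 1) x * f (sgn x)"])
      (simp_all add: nn_integral_sphere_measure)
  finally show ?thesis .
qed

text \<open>\<open>angular_mass\<close> fixes one unit vector by choice; an orthogonal map taking
  \<open>n\<close> to it, together with the invariance of the surface measure, removes the
  dependence on the choice.\<close>

lemma angular_mass_nn_integral:
  fixes n :: "real^'n"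
  assumes "angular_kernel TYPE('n) bhat" "norm n = 1"
  shows "(\<integral>\<^sup>+\<omega>. ennreal (bhat (\<omega> \<bullet> n)) \<partial>sphere_measure) = ennreal (angular_mass TYPE('n) bhat)"
proof -
  have [measurable]: "bhat \<in> borel_measurable borel"
    using assms by (simp add: angular_kernel_def)
  define n0 :: "real^'n" where "n0 = (SOME n. norm n = 1)"
  have n0: "norm n0 = 1"
    unfolding n0_def by (rule someI_ex) (use assms(2) in blast)
  obtain R where R: "orthogonal_transformation R" "R n = n0"
    using orthogonal_transformation_exists[of n n0] n0 assms(2) by auto
  have "(\<integral>\<^sup>+\<omega>. ennreal (bhat (\<omega> \<bullet> n)) \<partial>sphere_measure) =
      (\<integral>\<^sup>+\<omega>. ennreal (bhat (R \<omega> \<bullet> n0)) \<partial>sphere_measure)"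
    using R by (simp add: orthogonal_transformation_def flip: R(2))
  also have "\<dots> = (\<integral>\<^sup>+\<omega>. ennreal (bhat (\<omega> \<bullet> n0)) \<partial>sphere_measure)"
    by (rule nn_integral_sphere_measure_orthogonal[OF R(1)]) simp
  also have "\<dots> = ennreal (LINT \<omega>|sphere_measure. bhat (\<omega> \<bullet> n0))"
  proof (rule nn_integral_eq_integral)
    show "integrable sphere_measure (\<lambda>\<omega>. bhat (\<omega> \<bullet> n0))"
      using assms(1) n0 by (simp add: angular_kernel_def)
    show "AE \<omega> in sphere_measure. 0 \<le> bhat (\<omega> \<bullet> n0)"
      using AE_sphere_measure_norm
    proof eventually_elim
      case (elim \<omega>)
      then have "\<bar>\<omega> \<bullet> n0\<bar> \<le> 1"
        using Cauchy_Schwarz_ineq2[of \<omega> n0] n0 by simp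
      then show ?case
        using assms(1) by (auto simp: angular_kernel_def abs_le_iff)
    qed
  qed
  finally show ?thesis
    by (simp add: angular_mass_def n0_def)
qed

lemma angular_mass_pos:
  assumes "angular_kernel TYPE('n::finite) bhat"
  shows "0 < angular_mass TYPE('n) bhat"
proof -
  have "norm (SOME n :: real^'n. norm n = 1) = 1"
    by (rule someI_ex) (metis vector_choose_size zero_le_one)
  then show ?thesis
    using assms by (simp add: angular_kernel_def angular_mass_def)
qed

text \<open>Integrating out the angle turns the kernel into the weight of
  \<open>collision_frequency\<close>. At z = 0 both sides are 0 because
  \<open>0 powr \<beta> = 0\<close>.\<close>

lemma nn_integral_collision_kernel:
  fixes z :: "real^'n"
  assumes "angular_kernel TYPE('n) bhat"
  shows "(\<integral>\<^sup>+\<omega>. ennreal (collision_kernel \<beta> bhat z \<omega>) \<partial>sphere_measure) =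
    ennreal (angular_mass TYPE('n) bhat * norm z powr \<beta>)"
proof (cases "z = 0")
  case False
  have [measurable]: "bhat \<in> borel_measurable borel"
    using assms by (simp add: angular_kernel_def)
  have "(\<integral>\<^sup>+\<omega>. ennreal (collision_kernel \<beta> bhat z \<omega>) \<partial>sphere_measure) =
     ennreal (norm z powr \<beta>) * (\<integral>\<^sup>+\<omega>. ennreal (bhat (\<omega> \<bullet> sgn z)) \<partial>sphere_measure)"
    by (simp add: collision_kernel_def ennreal_mult' nn_integral_cmult)
  also have "\<dots> = ennreal (angular_mass TYPE('n) bhat * norm z powr \<beta>)"
    using angular_mass_nn_integral[OF assms, of "sgn z"] angular_mass_pos[OF assms] False
    by (simp add: norm_sgn ennreal_mult' mult.commute)
  finally show ?thesis .
qed (simp add: collision_kernel_def)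

section \<open>Finiteness of the constant and characteristics\<close>

text \<open>Relative to free motion from \<open>x0\<close> with velocity \<open>w\<close>, the
  characteristic of \<open>v\<close> runs along y - x0 + s (v - w). The Gaussian bound on
  \<open>M\<close> thus has the shape already estimated uniformly in \<open>v\<close> and
  \<open>y\<close>.\<close>

lemma nn_integral_maxwellian_characteristic_finite:
  fixes M :: "(real^'n) \<times> (real^'n) \<times> real \<Rightarrow> real"
  assumes "global_maxwellian M" "\<beta> \<in> {1 - real CARD('n)<..1}"
  obtains C :: ennreal where "C < \<infinity>"
    "\<And>v y. (\<integral>\<^sup>+s. \<integral>\<^sup>+w. ennreal (M (w, y + s *\<^sub>R v, s) * norm (v - w) powr \<beta>) \<partial>lborel \<partial>lborel) \<le> C"
proof -
  obtain K \<delta> v0 x0 where K: "0 < K" "0 < \<delta>"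
    and bnd: "\<And>v x t. M (v, x, t) \<le> K * exp (- \<delta> * ((norm (v - v0))\<^sup>2 + (norm (x - x0 - t *\<^sub>R v))\<^sup>2))"
    using global_maxwellian_gaussian_bound[OF assms(1)] by metis
  let ?g = "\<lambda>v y s w. exp (- \<delta> * ((norm (w - v0))\<^sup>2 + (norm (y + s *\<^sub>R (v - w)))\<^sup>2)) * norm (v - w) powr \<beta>"
  obtain C where C: "C < \<infinity>"
    "\<And>v y. (\<integral>\<^sup>+s. \<integral>\<^sup>+w. ennreal (?g v y s w) \<partial>lborel \<partial>lborel) \<le> C"
    using nn_integral_gaussian_characteristic_bounded[OF K(2), of \<beta> v0] assms(2) by auto
  show ?thesis
  proof (rule that[of "ennreal K * C"])
    show "ennreal K * C < \<infinity>" using C(1) by (simp add: ennreal_mult_less_top)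
    fix v y :: "real^'n"
    have "M (w, y + s *\<^sub>R v, s) * norm (v - w) powr \<beta> \<le> K * ?g v (y - x0) s w" for s w
      using mult_right_mono[OF bnd[of w "y + s *\<^sub>R v" s], of "norm (v - w) powr \<beta>"]
      by (simp add: algebra_simps)
    then have "(\<integral>\<^sup>+s. \<integral>\<^sup>+w. ennreal (M (w, y + s *\<^sub>R v, s) * norm (v - w) powr \<beta>) \<partial>lborel \<partial>lborel) \<le>
        (\<integral>\<^sup>+s. \<integral>\<^sup>+w. ennreal K * ennreal (?g v (y - x0) s w) \<partial>lborel \<partial>lborel)"
      using K(1) by (intro nn_integral_mono) (simp add: ennreal_leI flip: ennreal_mult)
    also have "\<dots> = ennreal K * (\<integral>\<^sup>+s. \<integral>\<^sup>+w. ennreal (?g v (y - x0) s w) \<partial>lborel \<partial>lborel)"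
      by (simp add: nn_integral_cmult)
    also have "\<dots> \<le> ennreal K * C"
      using C(2) by (intro mult_left_mono) auto
    finally show "(\<integral>\<^sup>+s. \<integral>\<^sup>+w. ennreal (M (w, y + s *\<^sub>R v, s) * norm (v - w) powr \<beta>) \<partial>lborel \<partial>lborel) \<le> ennreal K * C" .
  qed
qed

text \<open>The supremum in \<open>nu\<close> is known to dominate its members only once they are
  bounded above, and its Bochner integrals are tied to the nonnegative ones through integrability;
  the uniform constant \<open>C\<close> settles both.\<close>

lemma nn_integral_collision_frequency_le_nu:
  fixes M :: "(real^'n) \<times> (real^'n) \<times> real \<Rightarrow> real"
  assumes M: "global_maxwellian M" and b: "angular_kernel TYPE('n) bhat"
    and \<beta>: "\<beta> \<in> {1 - real CARD('n)<..1}"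
  shows "(\<integral>\<^sup>+s. \<integral>\<^sup>+w. ennreal (angular_mass TYPE('n) bhat * (M (w, y + s *\<^sub>R v, s) * norm (v - w) powr \<beta>))
      \<partial>lborel \<partial>lborel) \<le> ennreal (nu \<beta> bhat M)"
    and "0 \<le> nu \<beta> bhat M"
proof -
  obtain C where C: "C < \<infinity>"
    "\<And>v y. (\<integral>\<^sup>+s. \<integral>\<^sup>+w. ennreal (M (w, y + s *\<^sub>R v, s) * norm (v - w) powr \<beta>) \<partial>lborel \<partial>lborel) \<le> C"
    using nn_integral_maxwellian_characteristic_finite[OF M \<beta>] by blast
  have [measurable]: "M \<in> borel_measurable borel"
    by (rule global_maxwellian_measurable[OF M])
  have M0: "0 \<le> M p" for p using global_maxwellian_pos[OF M, of p] by simp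
  let ?m = "angular_mass TYPE('n) bhat"
  have m: "0 < ?m" by (rule angular_mass_pos[OF b])
  let ?I = "\<lambda>v y. LINT s|lborel. collision_frequency \<beta> bhat M (v, y + s *\<^sub>R v, s)"
  have I: "(\<integral>\<^sup>+s. \<integral>\<^sup>+w. ennreal (?m * (M (w, y + s *\<^sub>R v, s) * norm (v - w) powr \<beta>))
      \<partial>lborel \<partial>lborel) = ennreal (?I v y)" "0 \<le> ?I v y" for v y
  proof -
    let ?h = "\<lambda>(s, w). M (w, y + s *\<^sub>R v, s) * norm (v - w) powr \<beta>"
    have nn: "(\<integral>\<^sup>+p. ennreal (?h p) \<partial>(lborel \<Otimes>\<^sub>M lborel)) =
        (\<integral>\<^sup>+s. \<integral>\<^sup>+w. ennreal (M (w, y + s *\<^sub>R v, s) * norm (v - w) powr \<beta>) \<partial>lborel \<partial>lborel)"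
      by (subst lborel.nn_integral_fst[symmetric]) simp_all
    \<comment> \<open>Joint integrability in (s, w) identifies the iterated Bochner integral with
      the double one, even if the inner integral fails on a null set of times.\<close>
    have int: "integrable (lborel \<Otimes>\<^sub>M lborel) ?h"
    proof (rule integrableI_nonneg)
      show "(\<integral>\<^sup>+p. ennreal (?h p) \<partial>(lborel \<Otimes>\<^sub>M lborel)) < \<infinity>"
        unfolding nn using C by (rule le_less_trans[rotated])
    qed (auto simp: M0)
    have Ieq: "?I v y = ?m * (LINT p|(lborel \<Otimes>\<^sub>M lborel). ?h p)"
      using lborel_pair.integral_fst'[OF int] by (simp add: collision_frequency_def)
    show "0 \<le> ?I v y"
      unfolding Ieq using m by (intro mult_nonneg_nonneg integral_nonneg_AE) (auto simp: M0)
    have "(\<integral>\<^sup>+s. \<integral>\<^sup>+w. ennreal (?m * (M (w, y + s *\<^sub>R v, s) * norm (v - w) powr \<beta>)) \<partial>lborel \<partial>lborel) =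
        ennreal ?m * (\<integral>\<^sup>+p. ennreal (?h p) \<partial>(lborel \<Otimes>\<^sub>M lborel))"
      unfolding nn using m by (simp add: ennreal_mult' nn_integral_cmult)
    also have "\<dots> = ennreal (?I v y)"
      unfolding Ieq using m int
      by (subst nn_integral_eq_integral) (auto simp: M0 ennreal_mult' split: prod.split)
    finally show "(\<integral>\<^sup>+s. \<integral>\<^sup>+w. ennreal (?m * (M (w, y + s *\<^sub>R v, s) * norm (v - w) powr \<beta>)) \<partial>lborel \<partial>lborel) =
        ennreal (?I v y)" .
  qed
  have "ennreal (?I v y) \<le> ennreal ?m * C" for v y
    unfolding I(1)[symmetric] using C(2)[of y v] m
    by (simp add: ennreal_mult' nn_integral_cmult mult_left_mono)
  moreover have mC: "ennreal ?m * C < top" using C(1) by (simp add: ennreal_mult_less_top)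
  ultimately have "?I v y \<le> enn2real (ennreal ?m * C)" for v y
    using enn2real_mono[of "ennreal (?I v y)" "ennreal ?m * C"] I(2)[of v y] by simp
  then have bdd: "bdd_above (range (\<lambda>(v, x, t). \<bar>LINT s|lborel. collision_frequency \<beta> bhat M (v, x - t *\<^sub>R v + s *\<^sub>R v, s)\<bar>))"
    using I(2) by (intro bdd_aboveI[of _ "enn2real (ennreal ?m * C)"]) auto
  \<comment> \<open>With t = 0 the base point x - t v of the characteristic is \<open>y\<close>
    itself.\<close>
  have le: "?I v y \<le> nu \<beta> bhat M" for v y
    using cSUP_upper[OF UNIV_I bdd, of "(v, y, 0)"] by (simp add: nu_def)
  show "(\<integral>\<^sup>+s. \<integral>\<^sup>+w. ennreal (?m * (M (w, y + s *\<^sub>R v, s) * norm (v - w) powr \<beta>)) \<partial>lborel \<partial>lborel) \<le>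
      ennreal (nu \<beta> bhat M)"
    unfolding I(1) by (rule ennreal_leI[OF le])
  show "0 \<le> nu \<beta> bhat M" using I(2) le by (rule order_trans)
qed

section \<open>Space-time integrals and null sets along characteristics\<close>

lemma nn_integral_characteristics:
  fixes f :: "(real^'n) \<times> (real^'n) \<times> real \<Rightarrow> ennreal"
  assumes [measurable]: "f \<in> borel_measurable borel"
  shows "(\<integral>\<^sup>+z. \<integral>\<^sup>+s. f (fst z, snd z + s *\<^sub>R fst z, s) \<partial>lborel \<partial>lborel) = (\<integral>\<^sup>+p. f p \<partial>lborel)"
proof -
  have "(\<integral>\<^sup>+z. \<integral>\<^sup>+s. f (fst z, snd z + s *\<^sub>R fst z, s) \<partial>lborel \<partial>lborel) =
      (\<integral>\<^sup>+v. \<integral>\<^sup>+x. \<integral>\<^sup>+s. f (v, x + s *\<^sub>R v, s) \<partial>lborel \<partial>lborel \<partial>lborel)"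
    unfolding lborel_prod[symmetric, where 'a = "real^'n" and 'b = "real^'n"]
    by (subst lborel.nn_integral_fst[symmetric]) simp_all
  also have "\<dots> = (\<integral>\<^sup>+v. \<integral>\<^sup>+s. \<integral>\<^sup>+x. f (v, x + s *\<^sub>R v, s) \<partial>lborel \<partial>lborel \<partial>lborel)"
    by (intro nn_integral_cong lborel_pair.Fubini') simp
  \<comment> \<open>At fixed \<open>v\<close> and \<open>s\<close> the free flow is a translation in
    \<open>x\<close>, which is why the \<open>x\<close>-integral was moved innermost.\<close>
  also have "\<dots> = (\<integral>\<^sup>+v. \<integral>\<^sup>+s. \<integral>\<^sup>+x. f (v, x, s) \<partial>lborel \<partial>lborel \<partial>lborel)"
    by (intro nn_integral_cong nn_integral_lborel_translate[where f = "\<lambda>x. f (_, x, _)"]) simp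
  also have "\<dots> = (\<integral>\<^sup>+v. \<integral>\<^sup>+x. \<integral>\<^sup>+s. f (v, x, s) \<partial>lborel \<partial>lborel \<partial>lborel)"
    by (intro nn_integral_cong lborel_pair.Fubini') simp
  also have "\<dots> = (\<integral>\<^sup>+v. \<integral>\<^sup>+q. f (v, q) \<partial>(lborel \<Otimes>\<^sub>M lborel) \<partial>lborel)"
    by (intro nn_integral_cong) (subst lborel.nn_integral_fst[symmetric], simp_all add: lborel_prod)
  also have "\<dots> = (\<integral>\<^sup>+v. \<integral>\<^sup>+q. f (v, q) \<partial>lborel \<partial>lborel)"
    by (simp add: lborel_prod)
  also have "\<dots> = (\<integral>\<^sup>+p. f p \<partial>(lborel \<Otimes>\<^sub>M lborel))"
    by (rule lborel.nn_integral_fst) (simp add: lborel_prod)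
  finally show ?thesis by (simp add: lborel_prod)
qed

text \<open>The indicator \<open>g\<close> of the exceptional set can be integrated along
  characteristics. One direction brings the collision estimate onto characteristics, the other
  returns the final bound to space-time.\<close>

lemma AE_characteristics:
  fixes P :: "(real^'n) \<times> (real^'n) \<times> real \<Rightarrow> bool"
  assumes [measurable]: "Measurable.pred borel P"
  shows "(AE p in lborel. P p) \<longleftrightarrow>
    (AE z in lborel. AE s in lborel. P (fst z, snd z + s *\<^sub>R fst z, s))"
proof -
  define g :: "(real^'n) \<times> (real^'n) \<times> real \<Rightarrow> ennreal" where "g p = of_bool (\<not> P p)" for p
  have [measurable]: "g \<in> borel_measurable borel"
    unfolding g_def by measurable
  have meas: "(\<lambda>z. \<integral>\<^sup>+s. g (fst z, snd z + s *\<^sub>R fst z, s) \<partial>lborel) \<in> borel_measurable (borel \<Otimes>\<^sub>M borel)"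
    by measurable
  have g: "g p = 0 \<longleftrightarrow> P p" for p
    by (simp add: g_def)
  have "(AE p in lborel. P p) \<longleftrightarrow> (\<integral>\<^sup>+p. g p \<partial>lborel) = 0"
    by (subst nn_integral_0_iff_AE) (simp_all add: g)
  also have "\<dots> \<longleftrightarrow> (\<integral>\<^sup>+z. \<integral>\<^sup>+s. g (fst z, snd z + s *\<^sub>R fst z, s) \<partial>lborel \<partial>lborel) = 0"
    by (simp add: nn_integral_characteristics)
  also have "\<dots> \<longleftrightarrow> (AE z in lborel. (\<integral>\<^sup>+s. g (fst z, snd z + s *\<^sub>R fst z, s) \<partial>lborel) = 0)"
    by (rule nn_integral_0_iff_AE) (simp add: meas flip: borel_prod)
  also have "\<dots> \<longleftrightarrow> (AE z in lborel. AE s in lborel. P (fst z, snd z + s *\<^sub>R fst z, s))"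
    by (subst nn_integral_0_iff_AE) (simp_all add: g)
  finally show ?thesis .
qed

section \<open>Collision estimates\<close>

lemma continuous_on_post_v [continuous_intros]:
  fixes f g h :: "'a::topological_space \<Rightarrow> real^'n"
  assumes "continuous_on A f" "continuous_on A g" "continuous_on A h"
  shows "continuous_on A (\<lambda>x. post_v (f x) (g x) (h x))"
  unfolding post_v_def by (intro continuous_intros assms)

lemma continuous_on_post_w [continuous_intros]:
  fixes f g h :: "'a::topological_space \<Rightarrow> real^'n"
  assumes "continuous_on A f" "continuous_on A g" "continuous_on A h"
  shows "continuous_on A (\<lambda>x. post_w (f x) (g x) (h x))"
  unfolding post_w_def by (intro continuous_intros assms)

text \<open>On the pair (v, w) this is the reflection in the hyperplane orthogonal to (\<omega>,
  -\<omega>), a vector of squared norm 2. The passive component \<open>z\<close> carries position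
  and time.\<close>

lemma orthogonal_transformation_collision:
  fixes \<omega> :: "real^'n"
  assumes "norm \<omega> = 1"
  shows "orthogonal_transformation (\<lambda>((v, z :: 'z::real_inner), w). ((post_v v w \<omega>, z), post_w v w \<omega>))"
proof -
  have "\<omega> \<bullet> \<omega> = 1" using assms by (simp add: norm_eq_1)
  then show ?thesis
    unfolding orthogonal_transformation_def post_v_def post_w_def
    by (auto intro!: linearI simp: inner_add_left inner_add_right inner_diff_left inner_diff_right
        inner_commute algebra_simps)
qed

lemma orthogonal_transformation_swap_velocities:
  "orthogonal_transformation (\<lambda>((v :: 'a::real_inner, z :: 'z::real_inner), w). ((w, z), v))"
  unfolding orthogonal_transformation_def by (auto intro!: linearI)

lemma sets_sphere_measure_pair:
  "sets (sphere_measure \<Otimes>\<^sub>M (lborel :: 'z::euclidean_space measure)) = sets borel"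
  by (subst borel_prod[symmetric], intro sets_pair_measure_cong) simp_all

text \<open>
  The collision transformation is orthogonal for each fixed unit vector \<open>\<omega>\<close>, so it preserves
  null sets.
\<close>

lemma AE_collision_velocities:
  fixes P :: "(real^'n) \<times> (real^'n) \<times> real \<Rightarrow> bool"
  assumes P [measurable]: "Measurable.pred borel P" and ae: "AE p in lborel. P p"
  shows "AE (v, x, t) in lborel. AE (\<omega>, w) in (sphere_measure \<Otimes>\<^sub>M lborel).
    norm \<omega> = 1 \<and> P (v, x, t) \<and> P (w, x, t) \<and> P (post_v v w \<omega>, x, t) \<and> P (post_w v w \<omega>, x, t)"
proof -
  interpret S: finite_measure "sphere_measure :: (real^'n) measure"
    by (rule finite_measure_sphere_measure)
  interpret SQ: pair_sigma_finite "sphere_measure :: (real^'n) measure"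
      "lborel :: (((real^'n) \<times> (real^'n) \<times> real) \<times> (real^'n)) measure"
    by (intro pair_sigma_finite.intro S.sigma_finite_measure_axioms lborel.sigma_finite_measure_axioms)
  interpret SW: pair_sigma_finite "sphere_measure :: (real^'n) measure" "lborel :: (real^'n) measure"
    by (intro pair_sigma_finite.intro S.sigma_finite_measure_axioms lborel.sigma_finite_measure_axioms)
  \<comment> \<open>\<open>A\<close> tests only the first point of a pair. Composed with the swap,
    the collision, and the swap followed by the collision, it tests the other three points.\<close>
  define A :: "((real^'n) \<times> (real^'n) \<times> real) \<times> (real^'n) \<Rightarrow> bool" where "A q = P (fst q)" for q
  define \<Phi> :: "(real^'n) \<times> ((real^'n) \<times> (real^'n) \<times> real) \<times> (real^'n) \<Rightarrow> bool" where
    "\<Phi> = (\<lambda>(\<omega>, (v, x, t), w). norm \<omega> = 1 \<and> P (v, x, t) \<and> P (w, x, t) \<and>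
        P (post_v v w \<omega>, x, t) \<and> P (post_w v w \<omega>, x, t))"
  have pred_comp: "Measurable.pred borel (\<lambda>r. P (f r))" if "continuous_on UNIV f"
    for f :: "'z::topological_space \<Rightarrow> _"
    using measurable_compose[OF borel_measurable_continuous_onI[OF that] P] .
  have norm_pred: "Measurable.pred borel (\<lambda>r :: (real^'n) \<times> 'z::topological_space. norm (fst r) = 1)"
    by (rule measurable_compose[where g = "\<lambda>s. s = 1", OF borel_measurable_continuous_onI])
      (intro continuous_intros, measurable)
  have \<Phi>_meas: "Measurable.pred borel \<Phi>"
    unfolding \<Phi>_def case_prod_beta
    by (intro pred_intros_logic norm_pred pred_comp continuous_intros)
  have A: "Measurable.pred borel A"
    unfolding A_def by (simp add: pred_comp continuous_on_fst continuous_on_id)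
  have A_ae: "AE q in lborel. A q"
  proof -
    have "AE q in (lborel \<Otimes>\<^sub>M lborel). A q"
    proof (rule lborel_pair.AE_pair_measure)
      show "{q \<in> space (lborel \<Otimes>\<^sub>M lborel). A q} \<in> sets (lborel \<Otimes>\<^sub>M lborel)"
        using A unfolding lborel_prod by (simp add: pred_def)
      show "AE p in lborel. AE w in lborel. A (p, w)"
        using ae by eventually_elim (simp add: A_def)
    qed
    then show ?thesis unfolding lborel_prod .
  qed
  have "AE q in lborel. \<Phi> (\<omega>, q)" if \<omega>: "norm \<omega> = 1" for \<omega>
  proof -
    note R0 = orthogonal_transformation_swap_velocities[where 'a = "real^'n" and 'z = "(real^'n) \<times> real"]
    note R1 = orthogonal_transformation_collision[OF \<omega>, where 'z = "(real^'n) \<times> real"]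
    have R01: "orthogonal_transformation ((\<lambda>((v, z :: (real^'n) \<times> real), w). ((post_v v w \<omega>, z), post_w v w \<omega>)) \<circ>
        (\<lambda>((v, z), w). ((w, z), v)))"
      by (rule orthogonal_transformation_compose[OF R1 R0])
    show ?thesis
      using A_ae AE_lborel_orthogonal[OF R0 A A_ae] AE_lborel_orthogonal[OF R1 A A_ae]
        AE_lborel_orthogonal[OF R01 A A_ae]
    proof eventually_elim
      case (elim q)
      \<comment> \<open>Swapping the incoming velocities swaps the outgoing ones, so the composed
        map tests \<open>P\<close> at the second outgoing velocity.\<close>
      have "post_v w v \<omega> = post_w v w \<omega>" for v w
        by (simp add: post_v_def post_w_def inner_diff_left algebra_simps)
      with elim \<omega> show ?case
        by (cases q) (auto simp: \<Phi>_def A_def)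
    qed
  qed
  then have "AE \<omega> in sphere_measure. AE q in lborel. \<Phi> (\<omega>, q)"
    using AE_sphere_measure_norm by (auto elim: eventually_mono)
  moreover have "{r \<in> space (sphere_measure \<Otimes>\<^sub>M lborel). \<Phi> (fst r, snd r)} \<in> sets (sphere_measure \<Otimes>\<^sub>M lborel)"
  proof -
    show ?thesis using \<Phi>_meas unfolding sets_sphere_measure_pair by (simp add: space_pair_measure pred_def)
  qed
  \<comment> \<open>The collision map is orthogonal for fixed \<omega>, so \<omega> has been the
    outer variable; measurability of \<Phi> permits the exchange.\<close>
  ultimately have "AE q in lborel. AE \<omega> in sphere_measure. \<Phi> (\<omega>, q)"
    by (subst SQ.AE_commute[symmetric]) simp_all
  then have "AE p in lborel. AE w in lborel. AE \<omega> in sphere_measure. \<Phi> (\<omega>, p, w)"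
    unfolding lborel_prod[symmetric, where 'b = "real^'n" and 'a = "(real^'n) \<times> (real^'n) \<times> real"]
    by (rule lborel_pair.AE_pair)
  then show ?thesis
  proof eventually_elim
    case (elim p)
    have meas: "{y \<in> space (sphere_measure \<Otimes>\<^sub>M lborel). \<Phi> (fst y, p, snd y)} \<in> sets (sphere_measure \<Otimes>\<^sub>M lborel)"
    proof -
      have "Measurable.pred borel (\<lambda>y. \<Phi> (fst y, p, snd y))"
        by (rule measurable_compose[OF borel_measurable_continuous_onI \<Phi>_meas]) (intro continuous_intros)
      then show ?thesis unfolding sets_sphere_measure_pair by (simp add: space_pair_measure pred_def)
    qed
    have "AE \<omega> in sphere_measure. AE w in lborel. \<Phi> (\<omega>, p, w)"
      using elim meas by (subst SW.AE_commute) simp_all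
    then have "AE y in (sphere_measure \<Otimes>\<^sub>M lborel). \<Phi> (fst y, p, snd y)"
      using meas by (intro SW.AE_pair_measure) simp_all
    then show ?case
      by (cases p) (auto simp: \<Phi>_def case_prod_beta)
  qed
qed

lemma collision_kernel_nonneg:
  fixes z :: "real^'n"
  assumes "angular_kernel TYPE('n) bhat" "norm \<omega> = 1"
  shows "0 \<le> collision_kernel \<beta> bhat z \<omega>"
proof -
  have "\<bar>\<omega> \<bullet> sgn z\<bar> \<le> norm \<omega> * norm (sgn z)"
    by (rule Cauchy_Schwarz_ineq2)
  also have "\<dots> \<le> 1" using assms(2) by (simp add: norm_sgn)
  finally have "0 \<le> bhat (\<omega> \<bullet> sgn z)"
    using assms(1) by (auto simp: angular_kernel_def abs_le_iff)
  then show ?thesis by (simp add: collision_kernel_def)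
qed

lemma collision_kernel_measurable [measurable]:
  assumes [measurable]: "bhat \<in> borel_measurable borel" "f \<in> borel_measurable N" "g \<in> borel_measurable N"
  shows "(\<lambda>y. collision_kernel \<beta> bhat (f y :: real^'n) (g y)) \<in> borel_measurable N"
  unfolding collision_kernel_def by measurable

text \<open>The constant is d s rather than 2 d s because the two polarised products add up to twice
  the difference.\<close>

lemma abs_product_diff_le:
  fixes f f' g g' m m' d s :: real
  assumes "\<bar>f - g\<bar> \<le> d * m" "\<bar>f + g\<bar> \<le> s * m" "\<bar>f' - g'\<bar> \<le> d * m'" "\<bar>f' + g'\<bar> \<le> s * m'"
  shows "\<bar>f * f' - g * g'\<bar> \<le> d * s * (m * m')"
proof -
  have "\<bar>(f - g) * (f' + g')\<bar> \<le> (d * m) * (s * m')" "\<bar>(f + g) * (f' - g')\<bar> \<le> (s * m) * (d * m')"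
    using assms by (auto simp: abs_mult intro!: mult_mono intro: order_trans[OF abs_ge_zero])
  moreover have "2 * (f * f' - g * g') = (f - g) * (f' + g') + (f + g) * (f' - g')"
    by (simp add: algebra_simps)
  ultimately show ?thesis by (simp add: algebra_simps abs_le_iff)
qed

text \<open>The factor 2 comes from bounding gain and loss separately. The gain bound carries
  \<open>M\<close> at the outgoing velocities, and collision invariance brings it to the same form
  as the loss bound. Integrability of both integrands lets the difference of collision integrals be
  written as one integral.\<close>

lemma collision_integral_diff_le:
  fixes M F G :: "(real^'n) \<times> (real^'n) \<times> real \<Rightarrow> real"
  assumes M: "global_maxwellian M" and b: "angular_kernel TYPE('n) bhat"
    and [measurable]: "F \<in> borel_measurable borel" "G \<in> borel_measurable borel"
    and ds: "0 \<le> d" "0 \<le> s"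
    and d: "AE p in lborel. \<bar>F p - G p\<bar> \<le> d * M p" and s: "AE p in lborel. \<bar>F p + G p\<bar> \<le> s * M p"
    and int: "AE p in lborel. integrable (sphere_measure \<Otimes>\<^sub>M lborel) (collision_integrand \<beta> bhat F p)"
      "AE p in lborel. integrable (sphere_measure \<Otimes>\<^sub>M lborel) (collision_integrand \<beta> bhat G p)"
  shows "AE (v, x, t) in lborel. ennreal \<bar>collision_integral \<beta> bhat F (v, x, t) - collision_integral \<beta> bhat G (v, x, t)\<bar> \<le>
    ennreal (2 * d * s * M (v, x, t)) *
    (\<integral>\<^sup>+w. ennreal (angular_mass TYPE('n) bhat * (M (w, x, t) * norm (v - w) powr \<beta>)) \<partial>lborel)"
proof -
  have [measurable]: "M \<in> borel_measurable borel"
    by (rule global_maxwellian_measurable[OF M])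
  have [measurable]: "bhat \<in> borel_measurable borel"
    using b by (simp add: angular_kernel_def)
  interpret S: finite_measure "sphere_measure :: (real^'n) measure"
    by (rule finite_measure_sphere_measure)
  interpret SW: pair_sigma_finite "sphere_measure :: (real^'n) measure" "lborel :: (real^'n) measure"
    by (intro pair_sigma_finite.intro S.sigma_finite_measure_axioms lborel.sigma_finite_measure_axioms)
  let ?P = "\<lambda>p. \<bar>F p - G p\<bar> \<le> d * M p \<and> \<bar>F p + G p\<bar> \<le> s * M p"
  have "AE p in lborel. ?P p" using d s by eventually_elim simp
  then have "AE (v, x, t) in lborel. AE (\<omega>, w) in (sphere_measure \<Otimes>\<^sub>M lborel).
    norm \<omega> = 1 \<and> ?P (v, x, t) \<and> ?P (w, x, t) \<and> ?P (post_v v w \<omega>, x, t) \<and> ?P (post_w v w \<omega>, x, t)"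
    by (intro AE_collision_velocities) measurable
  with int show ?thesis
  proof eventually_elim
    case (elim p)
    obtain v x t where p: "p = (v, x, t)" by (cases p)
    let ?f = "collision_integrand \<beta> bhat F p" and ?g = "collision_integrand \<beta> bhat G p"
    let ?K = "2 * d * s * M (v, x, t)"
    have M0: "0 \<le> M q" for q using global_maxwellian_pos[OF M, of q] by simp
    have "ennreal \<bar>collision_integral \<beta> bhat F p - collision_integral \<beta> bhat G p\<bar> =
        ennreal (norm (LINT y|(sphere_measure \<Otimes>\<^sub>M lborel). ?f y - ?g y))"
      using elim(1,2) by (simp add: collision_integral_def)
    also have "\<dots> \<le> (\<integral>\<^sup>+y. ennreal (norm (?f y - ?g y)) \<partial>(sphere_measure \<Otimes>\<^sub>M lborel))"
      using elim(1,2) by (intro integral_norm_bound_ennreal) simp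
    also have "\<dots> \<le> (\<integral>\<^sup>+(\<omega>, w). ennreal (?K * M (w, x, t)) * ennreal (collision_kernel \<beta> bhat (v - w) \<omega>)
        \<partial>(sphere_measure \<Otimes>\<^sub>M lborel))"
    proof (rule nn_integral_mono_AE)
      from elim(3)[unfolded p prod.case]
      show "AE y in (sphere_measure \<Otimes>\<^sub>M lborel). ennreal (norm (?f y - ?g y)) \<le>
          (case y of (\<omega>, w) \<Rightarrow> ennreal (?K * M (w, x, t)) * ennreal (collision_kernel \<beta> bhat (v - w) \<omega>))"
      proof eventually_elim
        case (elim y)
        obtain \<omega> w where y: "y = (\<omega>, w)" by (cases y)
        let ?v = "post_v v w \<omega>" and ?w = "post_w v w \<omega>" and ?k = "collision_kernel \<beta> bhat (v - w) \<omega>"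
        have e: "norm \<omega> = 1" "?P (v, x, t)" "?P (w, x, t)" "?P (?v, x, t)" "?P (?w, x, t)"
          using elim by (auto simp: y)
        have k: "0 \<le> ?k" by (rule collision_kernel_nonneg[OF b e(1)])
        have 1: "\<bar>F (?v, x, t) * F (?w, x, t) - G (?v, x, t) * G (?w, x, t)\<bar> \<le> d * s * (M (?v, x, t) * M (?w, x, t))"
          using e(4,5) by (intro abs_product_diff_le) auto
        have 2: "\<bar>F (v, x, t) * F (w, x, t) - G (v, x, t) * G (w, x, t)\<bar> \<le> d * s * (M (v, x, t) * M (w, x, t))"
          using e(2,3) by (intro abs_product_diff_le) auto
        have "?f y - ?g y = ((F (?v, x, t) * F (?w, x, t) - G (?v, x, t) * G (?w, x, t)) -
            (F (v, x, t) * F (w, x, t) - G (v, x, t) * G (w, x, t))) * ?k"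
          by (simp add: collision_integrand_def p y algebra_simps)
        then have "norm (?f y - ?g y) = \<bar>(F (?v, x, t) * F (?w, x, t) - G (?v, x, t) * G (?w, x, t)) -
            (F (v, x, t) * F (w, x, t) - G (v, x, t) * G (w, x, t))\<bar> * ?k"
          using k by (simp add: abs_mult)
        also have "\<dots> \<le> (?K * M (w, x, t)) * ?k"
          using 1 2 unfolding global_maxwellian_collision[OF M e(1)]
          by (intro mult_right_mono[OF _ k]) (simp add: algebra_simps abs_le_iff)
        finally show ?case
          using ds M0 k by (simp add: y ennreal_leI flip: ennreal_mult)
      qed
    qed
    \<comment> \<open>The integrand is nonnegative by now, so Tonelli makes the angular integral the
      inner one.\<close>
    also have "\<dots> = (\<integral>\<^sup>+w. \<integral>\<^sup>+\<omega>. ennreal (?K * M (w, x, t)) * ennreal (collision_kernel \<beta> bhat (v - w) \<omega>)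
        \<partial>sphere_measure \<partial>lborel)"
      by (subst SW.nn_integral_snd[symmetric]) simp_all
    also have "\<dots> = (\<integral>\<^sup>+w. ennreal ?K * ennreal (angular_mass TYPE('n) bhat * (M (w, x, t) * norm (v - w) powr \<beta>)) \<partial>lborel)"
    proof (rule nn_integral_cong)
      fix w
      have "(\<integral>\<^sup>+\<omega>. ennreal (?K * M (w, x, t)) * ennreal (collision_kernel \<beta> bhat (v - w) \<omega>) \<partial>sphere_measure) =
          ennreal (?K * M (w, x, t)) * ennreal (angular_mass TYPE('n) bhat * norm (v - w) powr \<beta>)"
        by (simp add: nn_integral_cmult nn_integral_collision_kernel[OF b])
      also have "\<dots> = ennreal ?K * ennreal (angular_mass TYPE('n) bhat * (M (w, x, t) * norm (v - w) powr \<beta>))"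
        using ds M0 angular_mass_pos[OF b] by (simp add: mult_ac flip: ennreal_mult)
      finally show "(\<integral>\<^sup>+\<omega>. ennreal (?K * M (w, x, t)) * ennreal (collision_kernel \<beta> bhat (v - w) \<omega>) \<partial>sphere_measure) =
          ennreal ?K * ennreal (angular_mass TYPE('n) bhat * (M (w, x, t) * norm (v - w) powr \<beta>))" .
    qed
    also have "\<dots> = ennreal ?K * (\<integral>\<^sup>+w. ennreal (angular_mass TYPE('n) bhat * (M (w, x, t) * norm (v - w) powr \<beta>)) \<partial>lborel)"
      by (rule nn_integral_cmult) simp
    finally show ?case by (simp add: p)
  qed
qed

lemma collision_integral_measurable:
  fixes F :: "(real^'n) \<times> (real^'n) \<times> real \<Rightarrow> real"
  assumes [measurable]: "bhat \<in> borel_measurable borel" "F \<in> borel_measurable borel"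
  shows "collision_integral \<beta> bhat F \<in> borel_measurable borel"
proof -
  interpret S: finite_measure "sphere_measure :: (real^'n) measure"
    by (rule finite_measure_sphere_measure)
  interpret SW: pair_sigma_finite "sphere_measure :: (real^'n) measure" "lborel :: (real^'n) measure"
    by (intro pair_sigma_finite.intro S.sigma_finite_measure_axioms lborel.sigma_finite_measure_axioms)
  have [measurable]: "(\<lambda>r. post_v (f r) (g r) (h r)) \<in> borel_measurable N"
      "(\<lambda>r. post_w (f r) (g r) (h r)) \<in> borel_measurable N"
    if [measurable]: "f \<in> borel_measurable N" "g \<in> borel_measurable N" "h \<in> borel_measurable N"
    for f g h :: "'z \<Rightarrow> real^'n" and N
    unfolding post_v_def post_w_def by measurable
  have "(\<lambda>p. LINT y|(sphere_measure \<Otimes>\<^sub>M lborel). collision_integrand \<beta> bhat F p y)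
      \<in> borel_measurable (borel \<Otimes>\<^sub>M (borel \<Otimes>\<^sub>M borel))"
    unfolding collision_integrand_def case_prod_beta by measurable
  then show ?thesis
    unfolding collision_integral_def by (simp add: borel_prod)
qed

text \<open>The time integral runs over the whole line, as in \<open>nu\<close>, so the bound serves
  every interval between 0 and t, of either orientation.\<close>

lemma collision_integral_characteristic_le:
  fixes M F G :: "(real^'n) \<times> (real^'n) \<times> real \<Rightarrow> real"
  assumes M: "global_maxwellian M" and b: "angular_kernel TYPE('n) bhat"
    and \<beta>: "\<beta> \<in> {1 - real CARD('n)<..1}"
    and FG [measurable]: "F \<in> borel_measurable borel" "G \<in> borel_measurable borel"
    and ds: "0 \<le> d" "0 \<le> s"
    and d: "AE p in lborel. \<bar>F p - G p\<bar> \<le> d * M p" and s: "AE p in lborel. \<bar>F p + G p\<bar> \<le> s * M p"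
    and int: "AE p in lborel. integrable (sphere_measure \<Otimes>\<^sub>M lborel) (collision_integrand \<beta> bhat F p)"
      "AE p in lborel. integrable (sphere_measure \<Otimes>\<^sub>M lborel) (collision_integrand \<beta> bhat G p)"
  shows "AE (v, x) in lborel.
    (\<integral>\<^sup>+\<tau>. ennreal \<bar>collision_integral \<beta> bhat F (v, x + \<tau> *\<^sub>R v, \<tau>) - collision_integral \<beta> bhat G (v, x + \<tau> *\<^sub>R v, \<tau>)\<bar> \<partial>lborel)
      \<le> ennreal (2 * d * s * nu \<beta> bhat M * M (v, x, 0))"
proof -
  have [measurable]: "M \<in> borel_measurable borel"
    by (rule global_maxwellian_measurable[OF M])
  have [measurable]: "bhat \<in> borel_measurable borel"
    using b by (simp add: angular_kernel_def)
  have [measurable]: "collision_integral \<beta> bhat F \<in> borel_measurable borel"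
      "collision_integral \<beta> bhat G \<in> borel_measurable borel"
    by (simp_all add: collision_integral_measurable)
  let ?D = "\<lambda>p. ennreal \<bar>collision_integral \<beta> bhat F p - collision_integral \<beta> bhat G p\<bar>"
  let ?A = "\<lambda>v x t. \<integral>\<^sup>+w. ennreal (angular_mass TYPE('n) bhat * (M (w, x, t) * norm (v - w) powr \<beta>)) \<partial>lborel"
  have "Measurable.pred (borel \<Otimes>\<^sub>M (borel \<Otimes>\<^sub>M borel)) (\<lambda>(v, x, t). ?D (v, x, t) \<le> ennreal (2 * d * s * M (v, x, t)) * ?A v x t)"
    by measurable
  then have "Measurable.pred borel (\<lambda>(v, x, t). ?D (v, x, t) \<le> ennreal (2 * d * s * M (v, x, t)) * ?A v x t)"
    by (simp only: borel_prod)
  from AE_characteristics[THEN iffD1, OF this collision_integral_diff_le[OF M b FG ds d s int]]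
  have "AE z in lborel. AE \<tau> in lborel. ?D (fst z, snd z + \<tau> *\<^sub>R fst z, \<tau>) \<le>
      ennreal (2 * d * s * M (fst z, snd z + \<tau> *\<^sub>R fst z, \<tau>)) * ?A (fst z) (snd z + \<tau> *\<^sub>R fst z) \<tau>"
    by (simp only: prod.case)
  then show ?thesis
  proof eventually_elim
    case (elim z)
    obtain v x where z: "z = (v, x)" by (cases z)
    have M_eq: "M (v, x + \<tau> *\<^sub>R v, \<tau>) = M (v, x, 0)" for \<tau>
      using global_maxwellian_free_transport[OF M, of v x \<tau> 0] by simp
    have M0: "0 \<le> M q" for q using global_maxwellian_pos[OF M, of q] by simp
    let ?K = "2 * d * s * M (v, x, 0)"
    have "(\<integral>\<^sup>+\<tau>. ?D (v, x + \<tau> *\<^sub>R v, \<tau>) \<partial>lborel) \<le> (\<integral>\<^sup>+\<tau>. ennreal ?K * ?A v (x + \<tau> *\<^sub>R v) \<tau> \<partial>lborel)"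
      using elim by (intro nn_integral_mono_AE) (simp add: z M_eq)
    also have "\<dots> = ennreal ?K * (\<integral>\<^sup>+\<tau>. ?A v (x + \<tau> *\<^sub>R v) \<tau> \<partial>lborel)"
      by (rule nn_integral_cmult) simp
    also have "\<dots> \<le> ennreal ?K * ennreal (nu \<beta> bhat M)"
      by (intro mult_left_mono nn_integral_collision_frequency_le_nu[OF M b \<beta>]) simp
    also have "\<dots> = ennreal (2 * d * s * nu \<beta> bhat M * M (v, x, 0))"
      using ds M0 nn_integral_collision_frequency_le_nu(2)[OF M b \<beta>]
      by (simp add: mult_ac flip: ennreal_mult)
    finally show ?case by (simp add: z)
  qed
qed

section \<open>Weighted norms and stability\<close>

text \<open>\<open>real_of_ereal\<close> would send an infinite supremum to 0; membership excludes
  this, and comparison with the zero function excludes negative values.\<close>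

lemma esssup_eq_weighted_norm:
  fixes w f :: "'a::euclidean_space \<Rightarrow> real"
  assumes "f \<in> weighted_Linf w"
  shows "esssup lborel (\<lambda>p. ereal \<bar>f p / w p\<bar>) = ereal (weighted_norm w f)" and "0 \<le> weighted_norm w f"
proof -
  let ?e = "esssup lborel (\<lambda>p. ereal \<bar>f p / w p\<bar>)"
  have "esssup (lborel :: 'a measure) (\<lambda>_. 0 :: ereal) \<le> ?e"
    by (rule esssup_mono) simp_all
  then have "0 \<le> ?e"
    by (simp add: esssup_const)
  moreover have "?e < \<infinity>"
    using assms by (simp add: weighted_Linf_def)
  ultimately show "?e = ereal (weighted_norm w f)" "0 \<le> weighted_norm w f"
    unfolding weighted_norm_def by (cases ?e; simp)+
qed

lemma weighted_Linf_AE: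
  fixes w f :: "'a::euclidean_space \<Rightarrow> real"
  assumes f: "f \<in> weighted_Linf w" and w: "\<And>p. 0 < w p"
  shows "AE p in lborel. \<bar>f p\<bar> \<le> weighted_norm w f * w p"
  using esssup_AE[of "\<lambda>p. ereal \<bar>f p / w p\<bar>" lborel] unfolding esssup_eq_weighted_norm(1)[OF f]
proof eventually_elim
  case (elim p)
  then show ?case using w[of p] by (simp add: abs_divide pos_divide_le_eq)
qed

lemma weighted_LinfI:
  fixes w f :: "'a::euclidean_space \<Rightarrow> real"
  assumes [measurable]: "f \<in> borel_measurable borel" "w \<in> borel_measurable borel"
    and w: "\<And>p. 0 < w p" and le: "AE p in lborel. \<bar>f p\<bar> \<le> K * w p"
  shows "f \<in> weighted_Linf w" and "weighted_norm w f \<le> K"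
proof -
  have e: "esssup lborel (\<lambda>p. ereal \<bar>f p / w p\<bar>) \<le> ereal K"
  proof (rule esssup_I)
    show "AE p in lborel. ereal \<bar>f p / w p\<bar> \<le> ereal K"
      using le
    proof eventually_elim
      case (elim p)
      then show ?case using w[of p] by (simp add: abs_divide pos_divide_le_eq)
    qed
  qed simp
  also have "\<dots> < \<infinity>" by simp
  finally show f: "f \<in> weighted_Linf w"
    by (simp add: weighted_Linf_def)
  show "weighted_norm w f \<le> K"
    using e unfolding esssup_eq_weighted_norm(1)[OF f] by simp
qed

lemma weighted_Linf_diff:
  fixes w f g :: "'a::euclidean_space \<Rightarrow> real"
  assumes f: "f \<in> weighted_Linf w" and g: "g \<in> weighted_Linf w"
    and w: "w \<in> borel_measurable borel" "\<And>p. 0 < w p"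
  shows "(\<lambda>p. f p - g p) \<in> weighted_Linf w"
proof (rule weighted_LinfI)
  show "AE p in lborel. \<bar>f p - g p\<bar> \<le> (weighted_norm w f + weighted_norm w g) * w p"
    using weighted_Linf_AE[OF f w(2)] weighted_Linf_AE[OF g w(2)]
    by eventually_elim (simp add: distrib_right)
  have "f \<in> borel_measurable borel" "g \<in> borel_measurable borel"
    using f g by (auto simp: weighted_Linf_def)
  then show "(\<lambda>p. f p - g p) \<in> borel_measurable borel" by simp
qed (use w in auto)

lemma weighted_Linf_self:
  fixes w :: "'a::euclidean_space \<Rightarrow> real"
  assumes "w \<in> borel_measurable borel" "\<And>p. 0 < w p"
  shows "w \<in> weighted_Linf w"
  using assms by (intro weighted_LinfI(1)[where K = 1]) (auto simp: less_imp_le)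

text \<open>For b < a the interval integral is minus the integral over the reversed interval, so the
  bound is proved for integration over an arbitrary Borel set.\<close>

lemma interval_integral_diff_le:
  fixes f g :: "real \<Rightarrow> real" and a b :: real
  assumes f: "integrable lborel f" and g: "integrable lborel g"
    and B: "(\<integral>\<^sup>+s. ennreal \<bar>f s - g s\<bar> \<partial>lborel) \<le> ennreal B" "0 \<le> B"
  shows "\<bar>(LBINT s=a..b. f s) - (LBINT s=a..b. g s)\<bar> \<le> B"
proof -
  have set_int: "set_integrable lborel A h" if "integrable lborel h" "A \<in> sets borel"
    for h :: "real \<Rightarrow> real" and A
    using that unfolding set_integrable_def by (intro integrable_mult_indicator) simp_all
  have "(LBINT s=a..b. f s) - (LBINT s=a..b. g s) = (LBINT s=a..b. f s - g s)"
    using f g by (intro interval_lebesgue_integral_diff(2)[symmetric])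
      (simp_all add: interval_lebesgue_integrable_def set_int)
  moreover have "\<bar>LBINT s:A. f s - g s\<bar> \<le> B" if "A \<in> sets borel" for A
  proof -
    have "ennreal (norm (LBINT s:A. f s - g s)) \<le> (\<integral>\<^sup>+s. ennreal (norm (indicat_real A s *\<^sub>R (f s - g s))) \<partial>lborel)"
      using set_int[of "\<lambda>s. f s - g s" A] that f g unfolding set_lebesgue_integral_def
      by (intro integral_norm_bound_ennreal) (simp add: set_integrable_def)
    also have "\<dots> \<le> (\<integral>\<^sup>+s. ennreal \<bar>f s - g s\<bar> \<partial>lborel)"
      by (intro nn_integral_mono ennreal_leI) (simp add: indicator_def)
    also have "\<dots> \<le> ennreal B" by (rule B(1))
    finally show ?thesis using B(2) by simp
  qed
  ultimately show ?thesis
    by (simp add: interval_lebesgue_integral_def)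
qed

section \<open>Mild solutions along characteristics\<close>

lemma mild_solution_characteristic:
  assumes "mild_solution \<beta> bhat UNIV F"
  shows "AE (v, x) in lborel. \<forall>t. F (v, x + t *\<^sub>R v, t) =
    F (v, x, 0) + (LBINT s=(0::real)..t. collision_integral \<beta> bhat F (v, x + s *\<^sub>R v, s))"
proof -
  have "AE z in lborel. \<forall>t1\<in>UNIV. \<forall>t2\<in>UNIV. transport t2 (time_slice F t2) z = transport t1 (time_slice F t1) z +
        (LBINT s=t1..t2. transport s (time_slice (collision_integral \<beta> bhat F) s) z)"
    using assms unfolding mild_solution_def by blast
  then show ?thesis
  proof eventually_elim
    case (elim z)
    then have "transport t (time_slice F t) z = transport 0 (time_slice F 0) z +
        (LBINT s=(0::real)..t. transport s (time_slice (collision_integral \<beta> bhat F) s) z)" for t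
      by blast
    then show ?case
      by (cases z) (simp add: transport_def time_slice_def)
  qed
qed

text \<open>The difference estimate is applied with the zero function as \<open>G\<close>, taking
  for d and s the norm of \<open>F\<close>. The resulting integrability is what allows the two
  Duhamel integrals to be subtracted.\<close>

lemma collision_integral_characteristic_integrable:
  fixes M F :: "(real^'n) \<times> (real^'n) \<times> real \<Rightarrow> real"
  assumes M: "global_maxwellian M" and b: "angular_kernel TYPE('n) bhat"
    and \<beta>: "\<beta> \<in> {1 - real CARD('n)<..1}"
    and F: "F \<in> weighted_Linf M"
    and int: "AE p in lborel. integrable (sphere_measure \<Otimes>\<^sub>M lborel) (collision_integrand \<beta> bhat F p)"
  shows "AE (v, x) in lborel. integrable lborel (\<lambda>s. collision_integral \<beta> bhat F (v, x + s *\<^sub>R v, s))"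
proof -
  have F_meas: "F \<in> borel_measurable borel"
    using F by (simp add: weighted_Linf_def)
  have b_meas: "bhat \<in> borel_measurable borel"
    using b by (simp add: angular_kernel_def)
  have [simp]: "collision_integrand \<beta> bhat (\<lambda>_. 0) p y = 0" for p :: "(real^'n) \<times> (real^'n) \<times> real" and y
    by (cases p; cases y) (simp add: collision_integrand_def)
  have zero: "collision_integrand \<beta> bhat (\<lambda>_. 0) p = (\<lambda>_. 0)" for p :: "(real^'n) \<times> (real^'n) \<times> real"
    by (simp add: fun_eq_iff)
  note bnd = weighted_Linf_AE[OF F global_maxwellian_pos[OF M]] esssup_eq_weighted_norm(2)[OF F]
  have "AE (v, x) in lborel.
    (\<integral>\<^sup>+s. ennreal \<bar>collision_integral \<beta> bhat F (v, x + s *\<^sub>R v, s) - collision_integral \<beta> bhat (\<lambda>_. 0) (v, x + s *\<^sub>R v, s)\<bar> \<partial>lborel)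
      \<le> ennreal (2 * weighted_norm M F * weighted_norm M F * nu \<beta> bhat M * M (v, x, 0))"
    using bnd int by (intro collision_integral_characteristic_le[OF M b \<beta> F_meas]) (simp_all add: zero)
  then show ?thesis
  proof eventually_elim
    case (elim z)
    obtain v x where z: "z = (v, x)" by (cases z)
    have "(\<lambda>s. collision_integral \<beta> bhat F (v, x + s *\<^sub>R v, s)) \<in> borel_measurable borel"
      by (rule measurable_compose[OF borel_measurable_continuous_onI collision_integral_measurable[OF b_meas F_meas]])
        (intro continuous_intros)
    then show ?case
      using elim by (auto simp: z collision_integral_def integrable_iff_bounded elim: le_less_trans)
  qed
qed

text \<open>Clearing (1 - 4 \<nu>)^2 from the root, where 1 - 4 \<nu> > 0 enters, gives 4 \<nu> r =
  1 - 4 \<nu> - sqrt ((1 - 4 \<nu>)^2 - 8 \<nu> e) for a datum at distance e. The right side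
  increases with e, so \<epsilon> may replace e.\<close>

lemma orbit_radius_bound:
  assumes nu: "0 < nu \<beta> bhat M" "nu \<beta> bhat M < 1/4"
    and le: "weighted_norm (time_slice M 0) (\<lambda>z. Fin z - time_slice M 0 z) \<le> \<epsilon>"
    and "8 * nu \<beta> bhat M * \<epsilon> < (1 - 4 * nu \<beta> bhat M)\<^sup>2"
  shows "4 * nu \<beta> bhat M * orbit_radius \<beta> bhat M Fin \<le>
    1 - 4 * nu \<beta> bhat M - sqrt ((1 - 4 * nu \<beta> bhat M)\<^sup>2 - 8 * nu \<beta> bhat M * \<epsilon>)"
proof -
  let ?n = "nu \<beta> bhat M"
  define e where "e = weighted_norm (time_slice M 0) (\<lambda>z. Fin z - time_slice M 0 z)"
  define k where "k = 1 - 4 * ?n"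
  have k: "0 < k" using nu by (simp add: k_def)
  have "1 - 8 * ?n * e / k\<^sup>2 = (k\<^sup>2 - 8 * ?n * e) / k\<^sup>2"
    using k by (simp add: diff_divide_distrib)
  then have "sqrt (1 - 8 * ?n * e / k\<^sup>2) = sqrt (k\<^sup>2 - 8 * ?n * e) / k"
    using k by (simp add: real_sqrt_divide)
  then have "4 * ?n * orbit_radius \<beta> bhat M Fin = 4 * ?n * (1 / (4 * ?n) - 1) * (1 - sqrt (k\<^sup>2 - 8 * ?n * e) / k)"
    by (simp add: orbit_radius_def e_def k_def)
  also have "\<dots> = k * (1 - sqrt (k\<^sup>2 - 8 * ?n * e) / k)"
    using nu(1) by (simp add: k_def algebra_simps)
  also have "\<dots> = k - sqrt (k\<^sup>2 - 8 * ?n * e)"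
    using k by (simp add: algebra_simps)
  also have "\<dots> \<le> k - sqrt (k\<^sup>2 - 8 * ?n * \<epsilon>)"
    using nu(1) le by (simp add: e_def)
  finally show ?thesis by (simp add: k_def)
qed

text \<open>
  The Duhamel formula for \<open>F1 - F2\<close> along characteristics, on which \<open>M\<close> is constant.
\<close>

lemma mild_solutions_diff_le:
  fixes M F1 F2 :: "(real^'n) \<times> (real^'n) \<times> real \<Rightarrow> real"
  assumes M: "global_maxwellian M" and b: "angular_kernel TYPE('n) bhat"
    and \<beta>: "\<beta> \<in> {1 - real CARD('n)<..1}"
    and F: "F1 \<in> weighted_Linf M" "F2 \<in> weighted_Linf M"
    and mild: "mild_solution \<beta> bhat UNIV F1" "mild_solution \<beta> bhat UNIV F2"
    and init: "AE (v, x) in lborel. \<bar>F1 (v, x, 0) - F2 (v, x, 0)\<bar> \<le> d0 * M (v, x, 0)"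
    and s: "0 \<le> s" "AE p in lborel. \<bar>F1 p + F2 p\<bar> \<le> s * M p"
  shows "weighted_norm M (\<lambda>p. F1 p - F2 p) \<le> d0 + 2 * s * nu \<beta> bhat M * weighted_norm M (\<lambda>p. F1 p - F2 p)"
proof -
  note M_meas [measurable] = global_maxwellian_measurable[OF M]
  note M_pos = global_maxwellian_pos[OF M]
  have F_meas [measurable]: "F1 \<in> borel_measurable borel" "F2 \<in> borel_measurable borel"
    using F by (simp_all add: weighted_Linf_def)
  define d where "d = weighted_norm M (\<lambda>p. F1 p - F2 p)"
  have d: "AE p in lborel. \<bar>F1 p - F2 p\<bar> \<le> d * M p" "0 \<le> d"
    using weighted_Linf_diff[OF F M_meas M_pos]
    unfolding d_def by (auto intro!: weighted_Linf_AE esssup_eq_weighted_norm(2) M_pos)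
  have nu: "0 \<le> nu \<beta> bhat M"
    by (rule nn_integral_collision_frequency_le_nu(2)[OF M b \<beta>])
  have int: "AE p in lborel. integrable (sphere_measure \<Otimes>\<^sub>M lborel) (collision_integrand \<beta> bhat F1 p)"
    "AE p in lborel. integrable (sphere_measure \<Otimes>\<^sub>M lborel) (collision_integrand \<beta> bhat F2 p)"
    using mild by (simp_all add: mild_solution_def)
  have "AE z in lborel. \<forall>t. \<bar>F1 (fst z, snd z + t *\<^sub>R fst z, t) - F2 (fst z, snd z + t *\<^sub>R fst z, t)\<bar> \<le>
      (d0 + 2 * s * nu \<beta> bhat M * d) * M (fst z, snd z + t *\<^sub>R fst z, t)"
    using mild_solution_characteristic[OF mild(1)] mild_solution_characteristic[OF mild(2)] init
      collision_integral_characteristic_integrable[OF M b \<beta> F(1) int(1)]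
      collision_integral_characteristic_integrable[OF M b \<beta> F(2) int(2)]
      collision_integral_characteristic_le[OF M b \<beta> F_meas d(2) s(1) d(1) s(2) int]
  proof eventually_elim
    case (elim z)
    obtain v x where z: "z = (v, x)" by (cases z)
    let ?c = "\<lambda>F s. collision_integral \<beta> bhat F (v, x + s *\<^sub>R v, s)"
    show ?case
    proof
      fix t :: real
      have "\<bar>(LBINT s=(0::real)..t. ?c F1 s) - (LBINT s=(0::real)..t. ?c F2 s)\<bar> \<le> 2 * d * s * nu \<beta> bhat M * M (v, x, 0)"
        using elim(4-6) d(2) s(1) nu M_pos[of "(v, x, 0)"]
        by (intro interval_integral_diff_le) (simp_all add: z)
      moreover have "F1 (v, x + t *\<^sub>R v, t) = F1 (v, x, 0) + (LBINT s=(0::real)..t. ?c F1 s)"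
        "F2 (v, x + t *\<^sub>R v, t) = F2 (v, x, 0) + (LBINT s=(0::real)..t. ?c F2 s)"
        "\<bar>F1 (v, x, 0) - F2 (v, x, 0)\<bar> \<le> d0 * M (v, x, 0)"
        using elim(1-3) unfolding z prod.case by blast+
      ultimately have "\<bar>F1 (v, x + t *\<^sub>R v, t) - F2 (v, x + t *\<^sub>R v, t)\<bar> \<le>
          d0 * M (v, x, 0) + 2 * d * s * nu \<beta> bhat M * M (v, x, 0)"
        by linarith
      also have "\<dots> = (d0 + 2 * s * nu \<beta> bhat M * d) * M (v, x + t *\<^sub>R v, t)"
        using global_maxwellian_free_transport[OF M, of v x t 0] by (simp add: algebra_simps)
      finally show "\<bar>F1 (fst z, snd z + t *\<^sub>R fst z, t) - F2 (fst z, snd z + t *\<^sub>R fst z, t)\<bar> \<le>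
          (d0 + 2 * s * nu \<beta> bhat M * d) * M (fst z, snd z + t *\<^sub>R fst z, t)"
        by (simp add: z)
    qed
  qed
  \<comment> \<open>The bound at all times is weakened to almost every time, the form that transfers
    back to space-time.\<close>
  then have "AE z in lborel. AE t in lborel. \<bar>F1 (fst z, snd z + t *\<^sub>R fst z, t) - F2 (fst z, snd z + t *\<^sub>R fst z, t)\<bar> \<le>
      (d0 + 2 * s * nu \<beta> bhat M * d) * M (fst z, snd z + t *\<^sub>R fst z, t)"
    by eventually_elim simp
  then have "AE p in lborel. \<bar>F1 p - F2 p\<bar> \<le> (d0 + 2 * s * nu \<beta> bhat M * d) * M p"
    by (subst AE_characteristics) measurable
  then show ?thesis
    unfolding d_def by (intro weighted_LinfI(2)) (simp_all add: M_pos)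
qed

theorem theorem2p2:
  fixes \<beta> \<epsilon> :: real and bhat :: "real \<Rightarrow> real"
    and M F1 F2 :: "(real^'n) \<times> (real^'n) \<times> real \<Rightarrow> real"
    and Fin1 Fin2 :: "(real^'n) \<times> (real^'n) \<Rightarrow> real"
  assumes "angular_kernel TYPE('n) bhat"
    and "\<beta> \<in> {1 - real CARD('n)<..1}"
    and "global_maxwellian M"
    and "nu \<beta> bhat M < 1/4"
    and "Fin1 \<in> weighted_Linf (time_slice M 0)"
    and "Fin2 \<in> weighted_Linf (time_slice M 0)"
    and "\<epsilon> = max (weighted_norm (time_slice M 0) (\<lambda>z. Fin1 z - time_slice M 0 z))
                 (weighted_norm (time_slice M 0) (\<lambda>z. Fin2 z - time_slice M 0 z))"
    and "\<epsilon> < (1 - 4 * nu \<beta> bhat M)\<^sup>2 / (8 * nu \<beta> bhat M)"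
    and "solution_orbit \<beta> bhat M Fin1 F1"
    and "solution_orbit \<beta> bhat M Fin2 F2"
  shows "weighted_norm M (\<lambda>p. F1 p - F2 p) \<le>
           weighted_norm (time_slice M 0) (\<lambda>z. Fin1 z - Fin2 z) /
           sqrt ((1 - 4 * nu \<beta> bhat M)\<^sup>2 - 8 * nu \<beta> bhat M * \<epsilon>)"
proof -
  note b = assms(1) and \<beta> = assms(2) and M = assms(3)
  let ?n = "nu \<beta> bhat M" and ?M0 = "time_slice M 0"
  define d where "d = weighted_norm M (\<lambda>p. F1 p - F2 p)"
  define d0 where "d0 = weighted_norm ?M0 (\<lambda>z. Fin1 z - Fin2 z)"
  define r1 where "r1 = weighted_norm M (\<lambda>p. F1 p - M p)"
  define r2 where "r2 = weighted_norm M (\<lambda>p. F2 p - M p)"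
  define \<Delta> where "\<Delta> = (1 - 4 * ?n)\<^sup>2 - 8 * ?n * \<epsilon>"
  note M_meas = global_maxwellian_measurable[OF M]
  note M_pos = global_maxwellian_pos[OF M]
  note M_Linf = weighted_Linf_self[OF M_meas M_pos]
  have M0_pos: "0 < ?M0 z" for z
    using M_pos by (simp add: time_slice_def split: prod.split)
  have M0_meas: "?M0 \<in> borel_measurable borel"
    unfolding time_slice_def case_prod_beta
    by (rule measurable_compose[OF borel_measurable_continuous_onI M_meas]) (intro continuous_intros)
  note M0_Linf = weighted_Linf_self[OF M0_meas M0_pos]
  have F: "F1 \<in> weighted_Linf M" "F2 \<in> weighted_Linf M"
    and mild: "mild_solution \<beta> bhat UNIV F1" "mild_solution \<beta> bhat UNIV F2"
    and init: "AE z in lborel. time_slice F1 0 z = Fin1 z" "AE z in lborel. time_slice F2 0 z = Fin2 z"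
    and r: "r1 \<le> orbit_radius \<beta> bhat M Fin1" "r2 \<le> orbit_radius \<beta> bhat M Fin2"
    using assms(9,10) by (simp_all add: solution_orbit_def r1_def r2_def)
  have r1: "AE p in lborel. \<bar>F1 p - M p\<bar> \<le> r1 * M p" "0 \<le> r1"
    using weighted_Linf_diff[OF F(1) M_Linf M_meas M_pos]
    unfolding r1_def by (auto intro!: weighted_Linf_AE esssup_eq_weighted_norm(2) M_pos)
  have r2: "AE p in lborel. \<bar>F2 p - M p\<bar> \<le> r2 * M p" "0 \<le> r2"
    using weighted_Linf_diff[OF F(2) M_Linf M_meas M_pos]
    unfolding r2_def by (auto intro!: weighted_Linf_AE esssup_eq_weighted_norm(2) M_pos)
  note d = esssup_eq_weighted_norm(2)[OF weighted_Linf_diff[OF F M_meas M_pos], folded d_def]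
  have "0 \<le> weighted_norm ?M0 (\<lambda>z. Fin1 z - ?M0 z)"
    by (rule esssup_eq_weighted_norm(2)[OF weighted_Linf_diff[OF assms(5) M0_Linf M0_meas M0_pos]])
  moreover have e: "weighted_norm ?M0 (\<lambda>z. Fin1 z - ?M0 z) \<le> \<epsilon>" "weighted_norm ?M0 (\<lambda>z. Fin2 z - ?M0 z) \<le> \<epsilon>"
    using assms(7) by simp_all
  ultimately have \<epsilon>: "0 \<le> \<epsilon>" by linarith
  have n: "0 < ?n"
  proof -
    \<comment> \<open>Since \<open>x / 0 = 0\<close>, the smallness assumption with \<nu> = 0 would
      read \<epsilon> < 0.\<close>
    have "?n \<noteq> 0" using assms(8) \<epsilon> by auto
    then show ?thesis
      using nn_integral_collision_frequency_le_nu(2)[OF M b \<beta>] by simp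
  qed
  have small: "8 * ?n * \<epsilon> < (1 - 4 * ?n)\<^sup>2"
    using assms(8) n by (simp add: field_simps)
  then have \<Delta>: "0 < \<Delta>" by (simp add: \<Delta>_def)
  \<comment> \<open>\<epsilon> dominates both initial distances, so one and the same
    \<open>\<Delta>\<close> serves both solutions.\<close>
  have rad1: "4 * ?n * r1 \<le> 1 - 4 * ?n - sqrt \<Delta>"
  proof (rule order_trans)
    show "4 * ?n * r1 \<le> 4 * ?n * orbit_radius \<beta> bhat M Fin1"
      using r(1) n by simp
    show "4 * ?n * orbit_radius \<beta> bhat M Fin1 \<le> 1 - 4 * ?n - sqrt \<Delta>"
      unfolding \<Delta>_def by (rule orbit_radius_bound[OF n assms(4) e(1) small])
  qed
  have rad2: "4 * ?n * r2 \<le> 1 - 4 * ?n - sqrt \<Delta>"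
  proof (rule order_trans)
    show "4 * ?n * r2 \<le> 4 * ?n * orbit_radius \<beta> bhat M Fin2"
      using r(2) n by simp
    show "4 * ?n * orbit_radius \<beta> bhat M Fin2 \<le> 1 - 4 * ?n - sqrt \<Delta>"
      unfolding \<Delta>_def by (rule orbit_radius_bound[OF n assms(4) e(2) small])
  qed
  \<comment> \<open>F1 + F2 is written as 2 M + (F1 - M) + (F2 - M).\<close>
  have "AE p in lborel. \<bar>F1 p + F2 p\<bar> \<le> (2 + r1 + r2) * M p"
    using r1(1) r2(1)
  proof eventually_elim
    case (elim p)
    then show ?case using M_pos[of p] by (simp add: distrib_right abs_le_iff)
  qed
  moreover have "AE (v, x) in lborel. \<bar>F1 (v, x, 0) - F2 (v, x, 0)\<bar> \<le> d0 * M (v, x, 0)"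
    using init weighted_Linf_AE[OF weighted_Linf_diff[OF assms(5,6) M0_meas M0_pos] M0_pos, folded d0_def]
    by eventually_elim (auto simp: time_slice_def)
  ultimately have "d \<le> d0 + 2 * (2 + r1 + r2) * ?n * d"
    unfolding d_def using r1(2) r2(2) by (intro mild_solutions_diff_le[OF M b \<beta> F mild]) auto
  \<comment> \<open>The coefficient is the mean of 4 \<nu> (1 + r1) and 4 \<nu> (1 + r2), each at
    most 1 - sqrt \<Delta>.\<close>
  moreover have "2 * (2 + r1 + r2) * ?n * d \<le> (1 - sqrt \<Delta>) * d"
    using rad1 rad2 d by (intro mult_right_mono) (simp_all add: algebra_simps)
  ultimately have "d * sqrt \<Delta> \<le> d0"
    by (simp add: algebra_simps)
  then show ?thesis
    using \<Delta> by (simp add: pos_le_divide_eq d_def d0_def \<Delta>_def)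
qed

end
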